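(* Let \(\mathcal V\) be a universe. There is a nontrivial locally small \(\delta_{\mathcal V}\)-complete poset with decidable equality if and only if weak excluded middle in \(\mathcal V\) holds.
   Context: Work in univalent foundations (intensional Martin-Löf type theory with universes, function and propositional extensionality, propositional truncations). "There is" means one can construct such a structure, with carrier in any universe. A poset is a type \(X\) with a proposition-valued reflexive, transitive, antisymmetric relation \(\sqsubseteq\). It is \(\delta_{\mathcal V}\)-complete if for all \(x\sqsubseteq y\) and every proposition \(P:\mathcal V\), the family \(\delta_{x,y,P}:\mathbf 1+P\to X\), \(\mathrm{inl}(\star)\mapsto x\), \(\mathrm{inr}(p)\mapsto y\), has a supremum. It is nontrivial if it comes with designated \(x,y\) with \(x\sqsubseteq y\) and \(x\neq y\). It is locally small if there is a \(\mathcal V\)-valued relation \(\sqsubseteq_{\mathcal V}\) with \((x\sqsubseteq y)\simeq(x\sqsubseteq_{\mathcal V}y)\) for all \(x,y\). Decidable equality: for all \(x,y\), \((x=y)+\lnot(x=y)\). Weak excluded middle in \(\mathcal V\): for every proposition \(P:\mathcal V\), \(\lnot P\) or \(\lnot\lnot P\) holds. *)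

theory Defs
  imports Main
begin

text \<open>
  HOL validates excluded middle, and a shallow embedding would import it into the object theory
  (every HOL function would be an object-level function). The statement is therefore about
  derivability in an explicit calculus: intensional Martin-Loef type theory with a non-cumulative
  sequence of universes, function extensionality, propositional extensionality and propositional
  truncations. Terms are raw terms with de Bruijn indices; eliminators take their motive as an
  object-level function. Judgmental equality is untyped beta/iota-conversion; there are no eta
  rules, and no judgmental computation rule for the truncation.
\<close>

section \<open>Raw terms\<close>

datatype tm =
    Var nat
  | Univ nat
  | Prd tm tm    \<comment> \<open>dependent product; binds a variable in the second argument\<close>
  | Lam tm tm    \<comment> \<open>domain and body; binds a variable in the body\<close>
  | App tm tm
  | Sg tm tm     \<comment> \<open>dependent sum; binds a variable in the second argument\<close>
  | Pr tm tm
  | Split tm tm tm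
  | Emp nat      \<comment> \<open>a copy of the empty type in each universe, likewise for \<open>One\<close>\<close>
  | EmpInd tm tm
  | One nat
  | Star nat
  | OneInd tm tm tm
  | Sm tm tm
  | InL tm
  | InR tm
  | SumInd tm tm tm tm
  | Eq tm tm tm
  | Refl tm
  | J tm tm tm
  | N
  | Zero
  | Succ tm
  | NatInd tm tm tm tm
  | Trunc tm
  | TIn tm
  | TSquash tm tm
  | TRec tm tm tm tm
  | FunExt tm tm tm
  | PropExt tm tm tm tm tm tm

definition up_ren :: "(nat \<Rightarrow> nat) \<Rightarrow> nat \<Rightarrow> nat" where
  "up_ren r = case_nat 0 (\<lambda>i. Suc (r i))"

primrec ren :: "(nat \<Rightarrow> nat) \<Rightarrow> tm \<Rightarrow> tm" where
  "ren r (Var i) = Var (r i)"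
| "ren r (Univ i) = Univ i"
| "ren r (Prd A B) = Prd (ren r A) (ren (up_ren r) B)"
| "ren r (Lam A t) = Lam (ren r A) (ren (up_ren r) t)"
| "ren r (App f a) = App (ren r f) (ren r a)"
| "ren r (Sg A B) = Sg (ren r A) (ren (up_ren r) B)"
| "ren r (Pr a b) = Pr (ren r a) (ren r b)"
| "ren r (Split C g p) = Split (ren r C) (ren r g) (ren r p)"
| "ren r (Emp i) = Emp i"
| "ren r (EmpInd C e) = EmpInd (ren r C) (ren r e)"
| "ren r (One i) = One i"
| "ren r (Star i) = Star i"
| "ren r (OneInd C c x) = OneInd (ren r C) (ren r c) (ren r x)"
| "ren r (Sm A B) = Sm (ren r A) (ren r B)"
| "ren r (InL a) = InL (ren r a)"
| "ren r (InR b) = InR (ren r b)"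
| "ren r (SumInd C f g s) = SumInd (ren r C) (ren r f) (ren r g) (ren r s)"
| "ren r (Eq A a b) = Eq (ren r A) (ren r a) (ren r b)"
| "ren r (Refl a) = Refl (ren r a)"
| "ren r (J C d p) = J (ren r C) (ren r d) (ren r p)"
| "ren r N = N"
| "ren r Zero = Zero"
| "ren r (Succ n) = Succ (ren r n)"
| "ren r (NatInd C z s n) = NatInd (ren r C) (ren r z) (ren r s) (ren r n)"
| "ren r (Trunc A) = Trunc (ren r A)"
| "ren r (TIn a) = TIn (ren r a)"
| "ren r (TSquash x y) = TSquash (ren r x) (ren r y)"
| "ren r (TRec P h f x) = TRec (ren r P) (ren r h) (ren r f) (ren r x)"
| "ren r (FunExt f g h) = FunExt (ren r f) (ren r g) (ren r h)"
| "ren r (PropExt P Q h k f g) =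
     PropExt (ren r P) (ren r Q) (ren r h) (ren r k) (ren r f) (ren r g)"

definition wk :: "nat \<Rightarrow> tm \<Rightarrow> tm" where
  "wk k t = ren (\<lambda>i. i + k) t"

definition up_sub :: "(nat \<Rightarrow> tm) \<Rightarrow> nat \<Rightarrow> tm" where
  "up_sub s = case_nat (Var 0) (\<lambda>i. wk 1 (s i))"

primrec sub :: "(nat \<Rightarrow> tm) \<Rightarrow> tm \<Rightarrow> tm" where
  "sub r (Var i) = r i"
| "sub r (Univ i) = Univ i"
| "sub r (Prd A B) = Prd (sub r A) (sub (up_sub r) B)"
| "sub r (Lam A t) = Lam (sub r A) (sub (up_sub r) t)"
| "sub r (App f a) = App (sub r f) (sub r a)"
| "sub r (Sg A B) = Sg (sub r A) (sub (up_sub r) B)"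
| "sub r (Pr a b) = Pr (sub r a) (sub r b)"
| "sub r (Split C g p) = Split (sub r C) (sub r g) (sub r p)"
| "sub r (Emp i) = Emp i"
| "sub r (EmpInd C e) = EmpInd (sub r C) (sub r e)"
| "sub r (One i) = One i"
| "sub r (Star i) = Star i"
| "sub r (OneInd C c x) = OneInd (sub r C) (sub r c) (sub r x)"
| "sub r (Sm A B) = Sm (sub r A) (sub r B)"
| "sub r (InL a) = InL (sub r a)"
| "sub r (InR b) = InR (sub r b)"
| "sub r (SumInd C f g s) = SumInd (sub r C) (sub r f) (sub r g) (sub r s)"
| "sub r (Eq A a b) = Eq (sub r A) (sub r a) (sub r b)"
| "sub r (Refl a) = Refl (sub r a)"
| "sub r (J C d p) = J (sub r C) (sub r d) (sub r p)"
| "sub r N = N"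
| "sub r Zero = Zero"
| "sub r (Succ n) = Succ (sub r n)"
| "sub r (NatInd C z s n) = NatInd (sub r C) (sub r z) (sub r s) (sub r n)"
| "sub r (Trunc A) = Trunc (sub r A)"
| "sub r (TIn a) = TIn (sub r a)"
| "sub r (TSquash x y) = TSquash (sub r x) (sub r y)"
| "sub r (TRec P h f x) = TRec (sub r P) (sub r h) (sub r f) (sub r x)"
| "sub r (FunExt f g h) = FunExt (sub r f) (sub r g) (sub r h)"
| "sub r (PropExt P Q h k f g) =
     PropExt (sub r P) (sub r Q) (sub r h) (sub r k) (sub r f) (sub r g)"

definition inst :: "tm \<Rightarrow> tm \<Rightarrow> tm" where
  "inst t a = sub (case_nat a Var) t"

abbreviation App2 :: "tm \<Rightarrow> tm \<Rightarrow> tm \<Rightarrow> tm" where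
  "App2 f a b \<equiv> App (App f a) b"

definition Arr :: "tm \<Rightarrow> tm \<Rightarrow> tm" where
  "Arr A B = Prd A (wk 1 B)"

definition Prod :: "tm \<Rightarrow> tm \<Rightarrow> tm" where
  "Prod A B = Sg A (wk 1 B)"

definition IsProp :: "tm \<Rightarrow> tm" where
  "IsProp A = Prd A (Prd (wk 1 A) (Eq (wk 2 A) (Var 1) (Var 0)))"


section \<open>Judgmental equality\<close>

inductive conv :: "tm \<Rightarrow> tm \<Rightarrow> bool" (infix "\<approx>" 50) where
  conv_refl: "t \<approx> t"
| conv_sym: "s \<approx> t \<Longrightarrow> t \<approx> s"
| conv_trans: "s \<approx> t \<Longrightarrow> t \<approx> u \<Longrightarrow> s \<approx> u"

| beta: "App (Lam A t) a \<approx> inst t a"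
| iota_Split: "Split C g (Pr a b) \<approx> App2 g a b"
| iota_One: "OneInd C c (Star i) \<approx> c"
| iota_InL: "SumInd C f g (InL a) \<approx> App f a"
| iota_InR: "SumInd C f g (InR b) \<approx> App g b"
| iota_J: "J C d (Refl a) \<approx> App d a"
| iota_Zero: "NatInd C z s Zero \<approx> z"
| iota_Succ: "NatInd C z s (Succ n) \<approx> App2 s n (NatInd C z s n)"

| cong_Prd: "A \<approx> A' \<Longrightarrow> B \<approx> B' \<Longrightarrow> Prd A B \<approx> Prd A' B'"
| cong_Lam: "A \<approx> A' \<Longrightarrow> t \<approx> t' \<Longrightarrow> Lam A t \<approx> Lam A' t'"
| cong_App: "f \<approx> f' \<Longrightarrow> a \<approx> a' \<Longrightarrow> App f a \<approx> App f' a'"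
| cong_Sg: "A \<approx> A' \<Longrightarrow> B \<approx> B' \<Longrightarrow> Sg A B \<approx> Sg A' B'"
| cong_Pr: "a \<approx> a' \<Longrightarrow> b \<approx> b' \<Longrightarrow> Pr a b \<approx> Pr a' b'"
| cong_Split: "C \<approx> C' \<Longrightarrow> g \<approx> g' \<Longrightarrow> p \<approx> p' \<Longrightarrow> Split C g p \<approx> Split C' g' p'"
| cong_EmpInd: "C \<approx> C' \<Longrightarrow> e \<approx> e' \<Longrightarrow> EmpInd C e \<approx> EmpInd C' e'"
| cong_OneInd: "C \<approx> C' \<Longrightarrow> c \<approx> c' \<Longrightarrow> x \<approx> x' \<Longrightarrow> OneInd C c x \<approx> OneInd C' c' x'"
| cong_Sm: "A \<approx> A' \<Longrightarrow> B \<approx> B' \<Longrightarrow> Sm A B \<approx> Sm A' B'"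
| cong_InL: "a \<approx> a' \<Longrightarrow> InL a \<approx> InL a'"
| cong_InR: "b \<approx> b' \<Longrightarrow> InR b \<approx> InR b'"
| cong_SumInd: "C \<approx> C' \<Longrightarrow> f \<approx> f' \<Longrightarrow> g \<approx> g' \<Longrightarrow> s \<approx> s' \<Longrightarrow>
    SumInd C f g s \<approx> SumInd C' f' g' s'"
| cong_Eq: "A \<approx> A' \<Longrightarrow> a \<approx> a' \<Longrightarrow> b \<approx> b' \<Longrightarrow> Eq A a b \<approx> Eq A' a' b'"
| cong_Refl: "a \<approx> a' \<Longrightarrow> Refl a \<approx> Refl a'"
| cong_J: "C \<approx> C' \<Longrightarrow> d \<approx> d' \<Longrightarrow> p \<approx> p' \<Longrightarrow> J C d p \<approx> J C' d' p'"
| cong_Succ: "n \<approx> n' \<Longrightarrow> Succ n \<approx> Succ n'"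
| cong_NatInd: "C \<approx> C' \<Longrightarrow> z \<approx> z' \<Longrightarrow> s \<approx> s' \<Longrightarrow> n \<approx> n' \<Longrightarrow>
    NatInd C z s n \<approx> NatInd C' z' s' n'"
| cong_Trunc: "A \<approx> A' \<Longrightarrow> Trunc A \<approx> Trunc A'"
| cong_TIn: "a \<approx> a' \<Longrightarrow> TIn a \<approx> TIn a'"
| cong_TSquash: "x \<approx> x' \<Longrightarrow> y \<approx> y' \<Longrightarrow> TSquash x y \<approx> TSquash x' y'"
| cong_TRec: "P \<approx> P' \<Longrightarrow> h \<approx> h' \<Longrightarrow> f \<approx> f' \<Longrightarrow> x \<approx> x' \<Longrightarrow> TRec P h f x \<approx> TRec P' h' f' x'"
| cong_FunExt: "f \<approx> f' \<Longrightarrow> g \<approx> g' \<Longrightarrow> h \<approx> h' \<Longrightarrow> FunExt f g h \<approx> FunExt f' g' h'"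
| cong_PropExt: "P \<approx> P' \<Longrightarrow> Q \<approx> Q' \<Longrightarrow> h \<approx> h' \<Longrightarrow> k \<approx> k' \<Longrightarrow> f \<approx> f' \<Longrightarrow> g \<approx> g' \<Longrightarrow>
    PropExt P Q h k f g \<approx> PropExt P' Q' h' k' f' g'"


section \<open>Typing\<close>

text \<open>
  A context lists the types of its variables, innermost first; the entry at position \<open>i\<close> lives in
  the context formed by the entries after it, hence the weakening in the rule for variables.
\<close>

inductive wf_ctx :: "tm list \<Rightarrow> bool"
  and has_type :: "tm list \<Rightarrow> tm \<Rightarrow> tm \<Rightarrow> bool" ("_ \<turnstile> _ \<Colon> _" [50, 50, 50] 50) where
  wf_Nil: "wf_ctx []"
| wf_Cons: "wf_ctx \<Gamma> \<Longrightarrow> \<Gamma> \<turnstile> A \<Colon> Univ i \<Longrightarrow> wf_ctx (A # \<Gamma>)"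

| ty_Var: "wf_ctx \<Gamma> \<Longrightarrow> i < length \<Gamma> \<Longrightarrow> \<Gamma> \<turnstile> Var i \<Colon> wk (Suc i) (\<Gamma> ! i)"
| ty_conv: "\<Gamma> \<turnstile> t \<Colon> A \<Longrightarrow> A \<approx> B \<Longrightarrow> \<Gamma> \<turnstile> B \<Colon> Univ i \<Longrightarrow> \<Gamma> \<turnstile> t \<Colon> B"
| ty_Univ: "wf_ctx \<Gamma> \<Longrightarrow> \<Gamma> \<turnstile> Univ i \<Colon> Univ (Suc i)"

| ty_Prd: "\<Gamma> \<turnstile> A \<Colon> Univ i \<Longrightarrow> A # \<Gamma> \<turnstile> B \<Colon> Univ j \<Longrightarrow> \<Gamma> \<turnstile> Prd A B \<Colon> Univ (max i j)"
| ty_Lam: "\<Gamma> \<turnstile> A \<Colon> Univ i \<Longrightarrow> A # \<Gamma> \<turnstile> B \<Colon> Univ j \<Longrightarrow> A # \<Gamma> \<turnstile> t \<Colon> B \<Longrightarrow>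
    \<Gamma> \<turnstile> Lam A t \<Colon> Prd A B"
| ty_App: "\<Gamma> \<turnstile> f \<Colon> Prd A B \<Longrightarrow> \<Gamma> \<turnstile> a \<Colon> A \<Longrightarrow> \<Gamma> \<turnstile> App f a \<Colon> inst B a"

| ty_Sg: "\<Gamma> \<turnstile> A \<Colon> Univ i \<Longrightarrow> A # \<Gamma> \<turnstile> B \<Colon> Univ j \<Longrightarrow> \<Gamma> \<turnstile> Sg A B \<Colon> Univ (max i j)"
| ty_Pr: "\<Gamma> \<turnstile> A \<Colon> Univ i \<Longrightarrow> A # \<Gamma> \<turnstile> B \<Colon> Univ j \<Longrightarrow> \<Gamma> \<turnstile> a \<Colon> A \<Longrightarrow> \<Gamma> \<turnstile> b \<Colon> inst B a \<Longrightarrow>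
    \<Gamma> \<turnstile> Pr a b \<Colon> Sg A B"
| ty_Split: "\<Gamma> \<turnstile> C \<Colon> Prd (Sg A B) (Univ k) \<Longrightarrow>
    \<Gamma> \<turnstile> g \<Colon> Prd A (Prd B (App (wk 2 C) (Pr (Var 1) (Var 0)))) \<Longrightarrow>
    \<Gamma> \<turnstile> p \<Colon> Sg A B \<Longrightarrow>
    \<Gamma> \<turnstile> Split C g p \<Colon> App C p"

| ty_Emp: "wf_ctx \<Gamma> \<Longrightarrow> \<Gamma> \<turnstile> Emp i \<Colon> Univ i"
| ty_EmpInd: "\<Gamma> \<turnstile> C \<Colon> Prd (Emp i) (Univ k) \<Longrightarrow> \<Gamma> \<turnstile> e \<Colon> Emp i \<Longrightarrow> \<Gamma> \<turnstile> EmpInd C e \<Colon> App C e"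

| ty_One: "wf_ctx \<Gamma> \<Longrightarrow> \<Gamma> \<turnstile> One i \<Colon> Univ i"
| ty_Star: "wf_ctx \<Gamma> \<Longrightarrow> \<Gamma> \<turnstile> Star i \<Colon> One i"
| ty_OneInd: "\<Gamma> \<turnstile> C \<Colon> Prd (One i) (Univ k) \<Longrightarrow> \<Gamma> \<turnstile> c \<Colon> App C (Star i) \<Longrightarrow> \<Gamma> \<turnstile> x \<Colon> One i \<Longrightarrow>
    \<Gamma> \<turnstile> OneInd C c x \<Colon> App C x"

| ty_Sm: "\<Gamma> \<turnstile> A \<Colon> Univ i \<Longrightarrow> \<Gamma> \<turnstile> B \<Colon> Univ j \<Longrightarrow> \<Gamma> \<turnstile> Sm A B \<Colon> Univ (max i j)"
| ty_InL: "\<Gamma> \<turnstile> A \<Colon> Univ i \<Longrightarrow> \<Gamma> \<turnstile> B \<Colon> Univ j \<Longrightarrow> \<Gamma> \<turnstile> a \<Colon> A \<Longrightarrow> \<Gamma> \<turnstile> InL a \<Colon> Sm A B"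
| ty_InR: "\<Gamma> \<turnstile> A \<Colon> Univ i \<Longrightarrow> \<Gamma> \<turnstile> B \<Colon> Univ j \<Longrightarrow> \<Gamma> \<turnstile> b \<Colon> B \<Longrightarrow> \<Gamma> \<turnstile> InR b \<Colon> Sm A B"
| ty_SumInd: "\<Gamma> \<turnstile> C \<Colon> Prd (Sm A B) (Univ k) \<Longrightarrow>
    \<Gamma> \<turnstile> f \<Colon> Prd A (App (wk 1 C) (InL (Var 0))) \<Longrightarrow>
    \<Gamma> \<turnstile> g \<Colon> Prd B (App (wk 1 C) (InR (Var 0))) \<Longrightarrow>
    \<Gamma> \<turnstile> s \<Colon> Sm A B \<Longrightarrow>
    \<Gamma> \<turnstile> SumInd C f g s \<Colon> App C s"

| ty_Eq: "\<Gamma> \<turnstile> A \<Colon> Univ i \<Longrightarrow> \<Gamma> \<turnstile> a \<Colon> A \<Longrightarrow> \<Gamma> \<turnstile> b \<Colon> A \<Longrightarrow> \<Gamma> \<turnstile> Eq A a b \<Colon> Univ i"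
| ty_Refl: "\<Gamma> \<turnstile> A \<Colon> Univ i \<Longrightarrow> \<Gamma> \<turnstile> a \<Colon> A \<Longrightarrow> \<Gamma> \<turnstile> Refl a \<Colon> Eq A a a"
| ty_J: "\<Gamma> \<turnstile> C \<Colon> Prd A (Prd (wk 1 A) (Prd (Eq (wk 2 A) (Var 1) (Var 0)) (Univ k))) \<Longrightarrow>
    \<Gamma> \<turnstile> d \<Colon> Prd A (App (App2 (wk 1 C) (Var 0) (Var 0)) (Refl (Var 0))) \<Longrightarrow>
    \<Gamma> \<turnstile> p \<Colon> Eq A a b \<Longrightarrow>
    \<Gamma> \<turnstile> J C d p \<Colon> App (App2 C a b) p"

| ty_N: "wf_ctx \<Gamma> \<Longrightarrow> \<Gamma> \<turnstile> N \<Colon> Univ 0"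
| ty_Zero: "wf_ctx \<Gamma> \<Longrightarrow> \<Gamma> \<turnstile> Zero \<Colon> N"
| ty_Succ: "\<Gamma> \<turnstile> n \<Colon> N \<Longrightarrow> \<Gamma> \<turnstile> Succ n \<Colon> N"
| ty_NatInd: "\<Gamma> \<turnstile> C \<Colon> Prd N (Univ k) \<Longrightarrow>
    \<Gamma> \<turnstile> z \<Colon> App C Zero \<Longrightarrow>
    \<Gamma> \<turnstile> s \<Colon> Prd N (Arr (App (wk 1 C) (Var 0)) (App (wk 1 C) (Succ (Var 0)))) \<Longrightarrow>
    \<Gamma> \<turnstile> n \<Colon> N \<Longrightarrow>
    \<Gamma> \<turnstile> NatInd C z s n \<Colon> App C n"

| ty_Trunc: "\<Gamma> \<turnstile> A \<Colon> Univ i \<Longrightarrow> \<Gamma> \<turnstile> Trunc A \<Colon> Univ i"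
| ty_TIn: "\<Gamma> \<turnstile> A \<Colon> Univ i \<Longrightarrow> \<Gamma> \<turnstile> a \<Colon> A \<Longrightarrow> \<Gamma> \<turnstile> TIn a \<Colon> Trunc A"
| ty_TSquash: "\<Gamma> \<turnstile> A \<Colon> Univ i \<Longrightarrow> \<Gamma> \<turnstile> x \<Colon> Trunc A \<Longrightarrow> \<Gamma> \<turnstile> y \<Colon> Trunc A \<Longrightarrow>
    \<Gamma> \<turnstile> TSquash x y \<Colon> Eq (Trunc A) x y"
| ty_TRec: "\<Gamma> \<turnstile> P \<Colon> Univ j \<Longrightarrow> \<Gamma> \<turnstile> h \<Colon> IsProp P \<Longrightarrow> \<Gamma> \<turnstile> f \<Colon> Arr A P \<Longrightarrow> \<Gamma> \<turnstile> x \<Colon> Trunc A \<Longrightarrow>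
    \<Gamma> \<turnstile> TRec P h f x \<Colon> P"

| ty_FunExt: "\<Gamma> \<turnstile> f \<Colon> Prd A B \<Longrightarrow> \<Gamma> \<turnstile> g \<Colon> Prd A B \<Longrightarrow>
    \<Gamma> \<turnstile> h \<Colon> Prd A (Eq B (App (wk 1 f) (Var 0)) (App (wk 1 g) (Var 0))) \<Longrightarrow>
    \<Gamma> \<turnstile> FunExt f g h \<Colon> Eq (Prd A B) f g"
| ty_PropExt: "\<Gamma> \<turnstile> P \<Colon> Univ i \<Longrightarrow> \<Gamma> \<turnstile> Q \<Colon> Univ i \<Longrightarrow>
    \<Gamma> \<turnstile> h \<Colon> IsProp P \<Longrightarrow> \<Gamma> \<turnstile> k \<Colon> IsProp Q \<Longrightarrow>
    \<Gamma> \<turnstile> f \<Colon> Arr P Q \<Longrightarrow> \<Gamma> \<turnstile> g \<Colon> Arr Q P \<Longrightarrow>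
    \<Gamma> \<turnstile> PropExt P Q h k f g \<Colon> Eq (Univ i) P Q"

definition inhabited :: "tm \<Rightarrow> bool" where
  "inhabited A \<longleftrightarrow> (\<exists>t. [] \<turnstile> t \<Colon> A)"


section \<open>Logic inside the type theory\<close>

definition Neg :: "tm \<Rightarrow> tm" where
  "Neg A = Arr A (Emp 0)"

definition Disj :: "tm \<Rightarrow> tm \<Rightarrow> tm" where
  "Disj A B = Trunc (Sm A B)"

definition Iff :: "tm \<Rightarrow> tm \<Rightarrow> tm" where
  "Iff A B = Prod (Arr A B) (Arr B A)"

text \<open>Equivalences are maps with a left inverse and a right inverse.\<close>

definition Equiv :: "tm \<Rightarrow> tm \<Rightarrow> tm" where
  "Equiv A B = Sg (Arr A B) (Prod
     (Sg (Arr (wk 1 B) (wk 1 A))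
        (Prd (wk 2 A) (Eq (wk 3 A) (App (Var 1) (App (Var 2) (Var 0))) (Var 0))))
     (Sg (Arr (wk 1 B) (wk 1 A))
        (Prd (wk 2 B) (Eq (wk 3 B) (App (Var 2) (App (Var 1) (Var 0))) (Var 0)))))"

definition DecEq :: "tm \<Rightarrow> tm" where
  "DecEq X = Prd X (Prd (wk 1 X)
     (Sm (Eq (wk 2 X) (Var 1) (Var 0)) (Neg (Eq (wk 2 X) (Var 1) (Var 0)))))"

definition WEM :: "nat \<Rightarrow> tm" where
  "WEM v = Prd (Univ v) (Arr (IsProp (Var 0)) (Disj (Neg (Var 0)) (Neg (Neg (Var 0)))))"


section \<open>Posets inside the type theory\<close>

text \<open>\<open>X\<close> is the carrier and \<open>R\<close>, a term of type \<open>X \<rightarrow> X \<rightarrow> Univ t\<close>, the order.\<close>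

definition PropValued :: "tm \<Rightarrow> tm \<Rightarrow> tm" where
  "PropValued X R = Prd X (Prd (wk 1 X) (IsProp (App2 (wk 2 R) (Var 1) (Var 0))))"

definition Reflexive :: "tm \<Rightarrow> tm \<Rightarrow> tm" where
  "Reflexive X R = Prd X (App2 (wk 1 R) (Var 0) (Var 0))"

definition Transitive :: "tm \<Rightarrow> tm \<Rightarrow> tm" where
  "Transitive X R = Prd X (Prd (wk 1 X) (Prd (wk 2 X)
     (Arr (App2 (wk 3 R) (Var 2) (Var 1))
       (Arr (App2 (wk 3 R) (Var 1) (Var 0)) (App2 (wk 3 R) (Var 2) (Var 0))))))"

definition Antisymmetric :: "tm \<Rightarrow> tm \<Rightarrow> tm" where
  "Antisymmetric X R = Prd X (Prd (wk 1 X)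
     (Arr (App2 (wk 2 R) (Var 1) (Var 0))
       (Arr (App2 (wk 2 R) (Var 0) (Var 1)) (Eq (wk 2 X) (Var 1) (Var 0)))))"

definition IsPoset :: "tm \<Rightarrow> tm \<Rightarrow> tm" where
  "IsPoset X R =
     Prod (PropValued X R) (Prod (Reflexive X R) (Prod (Transitive X R) (Antisymmetric X R)))"

definition Nontrivial :: "tm \<Rightarrow> tm \<Rightarrow> tm" where
  "Nontrivial X R = Sg X (Sg (wk 1 X)
     (Prod (App2 (wk 2 R) (Var 1) (Var 0)) (Neg (Eq (wk 2 X) (Var 1) (Var 0)))))"

definition LocallySmall :: "nat \<Rightarrow> tm \<Rightarrow> tm \<Rightarrow> tm" where
  "LocallySmall v X R = Sg (Arr X (Arr X (Univ v)))
     (Prd (wk 1 X) (Prd (wk 2 X)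
       (Equiv (App2 (wk 3 R) (Var 1) (Var 0)) (App2 (Var 2) (Var 1) (Var 0)))))"

text \<open>\<open>s\<close> is an upper bound of the family \<open>\<alpha> : I \<rightarrow> X\<close>.\<close>

definition IsUB :: "tm \<Rightarrow> tm \<Rightarrow> tm \<Rightarrow> tm \<Rightarrow> tm" where
  "IsUB R I \<alpha> s = Prd I (App2 (wk 1 R) (App (wk 1 \<alpha>) (Var 0)) (wk 1 s))"

definition IsSup :: "tm \<Rightarrow> tm \<Rightarrow> tm \<Rightarrow> tm \<Rightarrow> tm \<Rightarrow> tm" where
  "IsSup X R I \<alpha> s = Prod (IsUB R I \<alpha> s)
     (Prd X (Arr (IsUB (wk 1 R) (wk 1 I) (wk 1 \<alpha>) (Var 0)) (App2 (wk 1 R) (wk 1 s) (Var 0))))"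

text \<open>Suprema are unique by antisymmetry, so no truncation is needed.\<close>

definition HasSup :: "tm \<Rightarrow> tm \<Rightarrow> tm \<Rightarrow> tm \<Rightarrow> tm" where
  "HasSup X R I \<alpha> = Sg X (IsSup (wk 1 X) (wk 1 R) (wk 1 I) (wk 1 \<alpha>) (Var 0))"

definition Delta :: "tm \<Rightarrow> tm \<Rightarrow> tm \<Rightarrow> tm \<Rightarrow> tm" where
  "Delta X x y P = Lam (Sm (One 0) P)
     (SumInd (Lam (Sm (One 0) (wk 1 P)) (wk 2 X))
       (Lam (One 0) (wk 2 x)) (Lam (wk 1 P) (wk 2 y)) (Var 0))"

text \<open>
  The five bound variables are \<open>x\<close>, \<open>y\<close>, the hypothesis that \<open>x\<close> is below \<open>y\<close>, \<open>P\<close>, and the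
  hypothesis that \<open>P\<close> is a proposition.
\<close>

definition DeltaComplete :: "nat \<Rightarrow> tm \<Rightarrow> tm \<Rightarrow> tm" where
  "DeltaComplete v X R = Prd X (Prd (wk 1 X) (Prd (App2 (wk 2 R) (Var 1) (Var 0))
     (Prd (Univ v) (Prd (IsProp (Var 0))
       (HasSup (wk 5 X) (wk 5 R) (Sm (One 0) (Var 1))
         (Delta (wk 5 X) (Var 4) (Var 3) (Var 1)))))))"

text \<open>
  The type of nontrivial locally small delta-complete posets (with respect to the universe \<open>v\<close>)
  with decidable equality, whose carrier lives in the universe \<open>u\<close> and whose order takes values
  in the universe \<open>t\<close>.
\<close>

definition NontrivialDecidablePosets :: "nat \<Rightarrow> nat \<Rightarrow> nat \<Rightarrow> tm" where
  "NontrivialDecidablePosets u t v =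
     Sg (Univ u) (Sg (Arr (Var 0) (Arr (Var 0) (Univ t)))
       (Prod (IsPoset (Var 1) (Var 0))
         (Prod (Nontrivial (Var 1) (Var 0))
           (Prod (LocallySmall v (Var 1) (Var 0))
             (Prod (DeltaComplete v (Var 1) (Var 0))
               (DecEq (Var 1)))))))"

end

(*
  If s is the supremum of the family 1 + P -> X with values x and y, where x is strictly below y,
  then P implies s = y, so s = x refutes P; conversely not-P forces s = x, so s distinct from x
  gives not-not-P. Hence deciding s = x proves weak excluded middle. In the other direction the
  two-element chain works: its order is stable under double negation, so the supremum may be taken
  to be x when not-P holds and y when not-not-P holds; since these two cases exclude each other,
  the truncation in weak excluded middle can be removed.

  Both implications are derived inside the calculus. Type correctness of the terms involved is
  reduced to rewriting by a type checker that is proved sound.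
*)

theory Submission
  imports Defs
begin

section \<open>Substitution\<close>

text \<open>The statement asks only that some closed term exists, so goals are read as sequents
  \<open>\<Gamma> \<tturnstile> T\<close>: the rules assemble the term behind the scenes, and only
  witnesses and short proof terms are given explicitly. These rules rest on substitution. Cut and
  transport instantiate a variable, and a case distinction on a hypothesis replaces it throughout
  the goal by a constructor; hence typing must be stable under all substitutions, and every assigned
  type must be a type. The levels \<open>u\<close>, \<open>t\<close> and \<open>v\<close> are
  arbitrary because each universe has its own copies of \<open>One\<close> and \<open>Emp\<close>,
  so the chain and its order can be placed anywhere. The price is that copies at different levels
  have to be compared, notably since negation always ends in \<open>Emp 0\<close>.\<close>

lemma up_ren_simps [simp]: "up_ren r 0 = 0" "up_ren r (Suc i) = Suc (r i)"
  by (simp_all add: up_ren_def)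

lemma up_sub_simps [simp]: "up_sub s 0 = Var 0" "up_sub s (Suc i) = wk 1 (s i)"
  by (simp_all add: up_sub_def)

lemma wk_Var [simp]: "wk k (Var i) = Var (i + k)"
  by (simp add: wk_def)

lemma up_sub_Var: "up_sub (\<lambda>i. Var (r i)) = (\<lambda>i. Var (up_ren r i))"
proof
  fix i show "up_sub (\<lambda>i. Var (r i)) i = Var (up_ren r i)" by (cases i) auto
qed

lemma ren_eq_sub: "ren r t = sub (\<lambda>i. Var (r i)) t"
  by (induction t arbitrary: r) (simp_all add: up_sub_Var)

lemma sub_Var [simp]: "sub Var t = t"
proof -
  have "up_sub Var = Var"
    using up_sub_Var[of id] by (simp add: fun_eq_iff up_ren_def split: nat.split)
  then show ?thesis by (induction t) simp_all
qed

lemma up_sub_up_ren: "up_sub s (up_ren r i) = up_sub (\<lambda>i. s (r i)) i"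
  by (cases i) simp_all

lemma sub_ren: "sub s (ren r t) = sub (\<lambda>i. s (r i)) t"
  by (induction t arbitrary: s r) (simp_all add: up_sub_up_ren)

lemma ren_ren: "ren r (ren r' t) = ren (\<lambda>i. r (r' i)) t"
proof -
  have "up_ren r (up_ren r' i) = up_ren (\<lambda>i. r (r' i)) i" for r r' i
    by (cases i) simp_all
  then show ?thesis
    by (induction t arbitrary: r r') simp_all
qed

lemma ren_up_sub: "ren (up_ren r) (up_sub s i) = up_sub (\<lambda>i. ren r (s i)) i"
  by (cases i) (simp_all add: wk_def ren_ren)

lemma ren_sub: "ren r (sub s t) = sub (\<lambda>i. ren r (s i)) t"
  by (induction t arbitrary: s r) (simp_all add: ren_up_sub)

text \<open>Lifting weakens, so at a successor index a renaming has to be moved past a substitution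
  on each side of the equation. This is why both mixed composition laws precede
  \<open>sub_sub\<close>.\<close>

lemma sub_up_sub: "sub (up_sub s) (up_sub s' i) = up_sub (\<lambda>i. sub s (s' i)) i"
  by (cases i) (simp_all add: wk_def sub_ren ren_sub)

lemma sub_sub: "sub s (sub s' t) = sub (\<lambda>i. sub s (s' i)) t"
  by (induction t arbitrary: s s') (simp_all add: sub_up_sub)

lemma sub_wk: "sub s (wk k t) = sub (\<lambda>i. s (i + k)) t"
  by (simp add: wk_def sub_ren)

lemma wk_sub: "wk k (sub s t) = sub (\<lambda>i. wk k (s i)) t"
  by (simp add: wk_def ren_sub)

lemma wk_wk [simp]: "wk j (wk k t) = wk (k + j) t"
  by (simp add: wk_def ren_eq_sub sub_sub add.assoc)

lemma wk_Univ [simp]: "wk k (Univ i) = Univ i"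
  by (simp add: wk_def)

lemma wk_0 [simp]: "wk 0 t = t"
  by (simp add: wk_def ren_eq_sub)

lemma sub_up_wk1: "sub (up_sub s) (wk (Suc 0) t) = wk 1 (sub s t)"
  by (simp add: sub_wk wk_sub)

lemma sub_up_wk2: "sub (up_sub (up_sub s)) (wk 2 t) = wk 2 (sub s t)"
  by (simp add: sub_wk wk_sub numeral_2_eq_2)

lemma inst_wk [simp]: "inst (wk (Suc k) t) a = wk k t"
  by (simp add: inst_def sub_wk) (simp add: wk_def ren_eq_sub)

text \<open>This is what makes beta, and the type of an application, stable under
  substitution.\<close>

lemma sub_inst: "sub s (inst t a) = inst (sub (up_sub s) t) (sub s a)"
proof -
  have "sub s (case_nat a Var i) = sub (case_nat (sub s a) Var) (up_sub s i)" for i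
    by (cases i) (simp_all add: sub_wk)
  then show ?thesis
    by (simp add: inst_def sub_sub)
qed

lemma sub_Arr [simp]: "sub s (Arr A B) = Arr (sub s A) (sub s B)"
  by (simp add: Arr_def sub_up_wk1)

lemma sub_IsProp [simp]: "sub s (IsProp A) = IsProp (sub s A)"
  by (simp add: IsProp_def sub_up_wk1 sub_up_wk2)

lemma conv_sub: "s \<approx> t \<Longrightarrow> sub r s \<approx> sub r t"
  by (induction arbitrary: r rule: conv.induct)
    (auto simp: sub_inst intro: conv.intros)

section \<open>Stability of typing under substitution\<close>

text \<open>The conversion rule is left out: its conclusion matches everything, so search with it diverges.\<close>

lemmas typing_rules = wf_ctx_has_type.intros(1-3,5-33)

text \<open>
  Lifting a substitution under a binder already weakens its terms. Abstracting over the class \<open>S\<close> of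
  substitutions lets the same induction serve first for renamings and then for all substitutions.
\<close>

lemma typing_sub_general:
  assumes vars: "\<And>s \<Gamma> \<Delta> i. S s \<Gamma> \<Delta> \<Longrightarrow> wf_ctx \<Delta> \<Longrightarrow> i < length \<Gamma> \<Longrightarrow>
      \<Delta> \<turnstile> s i \<Colon> sub s (wk (Suc i) (\<Gamma> ! i))"
    and lift: "\<And>s \<Gamma> \<Delta> A j. S s \<Gamma> \<Delta> \<Longrightarrow> \<Delta> \<turnstile> sub s A \<Colon> Univ j \<Longrightarrow>
      S (up_sub s) (A # \<Gamma>) (sub s A # \<Delta>)"
  shows "\<Gamma> \<turnstile> t \<Colon> A \<Longrightarrow> S s \<Gamma> \<Delta> \<Longrightarrow> wf_ctx \<Delta> \<Longrightarrow> \<Delta> \<turnstile> sub s t \<Colon> sub s A"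
proof (induction arbitrary: s \<Delta> rule: wf_ctx_has_type.inducts(2)[where ?P1.0 = "\<lambda>_. True"])
  case (ty_Var \<Gamma> i)
  then show ?case by (simp add: vars)
next
  case (ty_conv \<Gamma> t A B i)
  from ty_conv.IH(2)[OF ty_conv.prems] have "\<Delta> \<turnstile> sub s B \<Colon> Univ i" by simp
  with ty_conv.IH(1)[OF ty_conv.prems] conv_sub[OF ty_conv.hyps(2)] show ?case
    by (rule wf_ctx_has_type.ty_conv)
next
  case (ty_Prd \<Gamma> A i B j)
  have A: "\<Delta> \<turnstile> sub s A \<Colon> Univ i"
    using ty_Prd.IH(1)[OF ty_Prd.prems] by simp
  note under = lift[OF ty_Prd.prems(1) A] wf_Cons[OF ty_Prd.prems(2) A]
  show ?case
    using A ty_Prd.IH(2)[OF under] by (auto intro: wf_ctx_has_type.ty_Prd)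
next
  case (ty_Lam \<Gamma> A i B j t)
  have A: "\<Delta> \<turnstile> sub s A \<Colon> Univ i"
    using ty_Lam.IH(1)[OF ty_Lam.prems] by simp
  note under = lift[OF ty_Lam.prems(1) A] wf_Cons[OF ty_Lam.prems(2) A]
  show ?case
    using A ty_Lam.IH(2,3)[OF under] by (auto intro: wf_ctx_has_type.ty_Lam)
next
  case (ty_App \<Gamma> f A B a)
  from ty_App.IH[OF ty_App.prems] show ?case
    by (simp add: sub_inst sub_up_wk1 sub_up_wk2) (rule wf_ctx_has_type.ty_App[unfolded One_nat_def])
next
  case (ty_Sg \<Gamma> A i B j)
  have A: "\<Delta> \<turnstile> sub s A \<Colon> Univ i"
    using ty_Sg.IH(1)[OF ty_Sg.prems] by simp
  note under = lift[OF ty_Sg.prems(1) A] wf_Cons[OF ty_Sg.prems(2) A]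
  show ?case
    using A ty_Sg.IH(2)[OF under] by (auto intro: wf_ctx_has_type.ty_Sg)
next
  case (ty_Pr \<Gamma> A i B j a b)
  have A: "\<Delta> \<turnstile> sub s A \<Colon> Univ i"
    using ty_Pr.IH(1)[OF ty_Pr.prems] by simp
  note under = lift[OF ty_Pr.prems(1) A] wf_Cons[OF ty_Pr.prems(2) A]
  show ?case
    using A ty_Pr.IH(2)[OF under] ty_Pr.IH(3,4)[OF ty_Pr.prems]
    by (auto simp: sub_inst intro: wf_ctx_has_type.ty_Pr)
next
  case (ty_Split \<Gamma> C A B k g p)
  from ty_Split.IH[OF ty_Split.prems] show ?case
    by (simp add: sub_inst sub_up_wk1 sub_up_wk2) (rule wf_ctx_has_type.ty_Split[unfolded One_nat_def])
next
  case (ty_EmpInd \<Gamma> C i k e)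
  from ty_EmpInd.IH[OF ty_EmpInd.prems] show ?case
    by (simp add: sub_inst sub_up_wk1 sub_up_wk2) (rule wf_ctx_has_type.ty_EmpInd[unfolded One_nat_def])
next
  case (ty_OneInd \<Gamma> C i k c x)
  from ty_OneInd.IH[OF ty_OneInd.prems] show ?case
    by (simp add: sub_inst sub_up_wk1 sub_up_wk2) (rule wf_ctx_has_type.ty_OneInd[unfolded One_nat_def])
next
  case (ty_Sm \<Gamma> A i B j)
  from ty_Sm.IH[OF ty_Sm.prems] show ?case
    by (simp add: sub_inst sub_up_wk1 sub_up_wk2) (rule wf_ctx_has_type.ty_Sm[unfolded One_nat_def])
next
  case (ty_InL \<Gamma> A i B j a)
  from ty_InL.IH[OF ty_InL.prems] show ?case
    by (simp add: sub_inst sub_up_wk1 sub_up_wk2) (rule wf_ctx_has_type.ty_InL[unfolded One_nat_def])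
next
  case (ty_InR \<Gamma> A i B j b)
  from ty_InR.IH[OF ty_InR.prems] show ?case
    by (simp add: sub_inst sub_up_wk1 sub_up_wk2) (rule wf_ctx_has_type.ty_InR[unfolded One_nat_def])
next
  case (ty_SumInd \<Gamma> C A B k f g t)
  from ty_SumInd.IH[OF ty_SumInd.prems] show ?case
    by (simp add: sub_inst sub_up_wk1 sub_up_wk2) (rule wf_ctx_has_type.ty_SumInd[unfolded One_nat_def])
next
  case (ty_Eq \<Gamma> A i a b)
  from ty_Eq.IH[OF ty_Eq.prems] show ?case
    by (simp add: sub_inst sub_up_wk1 sub_up_wk2) (rule wf_ctx_has_type.ty_Eq[unfolded One_nat_def])
next
  case (ty_Refl \<Gamma> A i a)
  from ty_Refl.IH[OF ty_Refl.prems] show ?case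
    by (simp add: sub_inst sub_up_wk1 sub_up_wk2) (rule wf_ctx_has_type.ty_Refl[unfolded One_nat_def])
next
  case (ty_J \<Gamma> C A k d p a b)
  from ty_J.IH[OF ty_J.prems] show ?case
    by (simp add: sub_inst sub_up_wk1 sub_up_wk2) (rule wf_ctx_has_type.ty_J[unfolded One_nat_def])
next
  case (ty_Succ \<Gamma> n)
  from ty_Succ.IH[OF ty_Succ.prems] show ?case
    by (simp add: sub_inst sub_up_wk1 sub_up_wk2) (rule wf_ctx_has_type.ty_Succ[unfolded One_nat_def])
next
  case (ty_NatInd \<Gamma> C k z t n)
  from ty_NatInd.IH[OF ty_NatInd.prems] show ?case
    by (simp add: sub_inst sub_up_wk1 sub_up_wk2) (rule wf_ctx_has_type.ty_NatInd[unfolded One_nat_def])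
next
  case (ty_Trunc \<Gamma> A i)
  from ty_Trunc.IH[OF ty_Trunc.prems] show ?case
    by (simp add: sub_inst sub_up_wk1 sub_up_wk2) (rule wf_ctx_has_type.ty_Trunc[unfolded One_nat_def])
next
  case (ty_TIn \<Gamma> A i a)
  from ty_TIn.IH[OF ty_TIn.prems] show ?case
    by (simp add: sub_inst sub_up_wk1 sub_up_wk2) (rule wf_ctx_has_type.ty_TIn[unfolded One_nat_def])
next
  case (ty_TSquash \<Gamma> A i x y)
  from ty_TSquash.IH[OF ty_TSquash.prems] show ?case
    by (simp add: sub_inst sub_up_wk1 sub_up_wk2) (rule wf_ctx_has_type.ty_TSquash[unfolded One_nat_def])
next
  case (ty_TRec \<Gamma> P j h f A x)
  from ty_TRec.IH[OF ty_TRec.prems] show ?case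
    by (simp add: sub_inst sub_up_wk1 sub_up_wk2) (rule wf_ctx_has_type.ty_TRec[unfolded One_nat_def])
next
  case (ty_FunExt \<Gamma> f A B g h)
  from ty_FunExt.IH[OF ty_FunExt.prems] show ?case
    by (simp add: sub_inst sub_up_wk1 sub_up_wk2) (rule wf_ctx_has_type.ty_FunExt[unfolded One_nat_def])
next
  case (ty_PropExt \<Gamma> P i Q h k f g)
  from ty_PropExt.IH[OF ty_PropExt.prems] show ?case
    by (simp add: sub_inst sub_up_wk1 sub_up_wk2) (rule wf_ctx_has_type.ty_PropExt[unfolded One_nat_def])
qed (auto intro: typing_rules)

text \<open>An entry of a context is a type over the entries after it only; the condition on
  \<open>r\<close> therefore compares weakened entries, which live over the full contexts.\<close>

lemma typing_ren:
  assumes "\<Gamma> \<turnstile> t \<Colon> A" "wf_ctx \<Delta>"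
    and "\<And>i. i < length \<Gamma> \<Longrightarrow> r i < length \<Delta> \<and> ren r (wk (Suc i) (\<Gamma> ! i)) = wk (Suc (r i)) (\<Delta> ! r i)"
  shows "\<Delta> \<turnstile> ren r t \<Colon> ren r A"
  unfolding ren_eq_sub
proof (rule typing_sub_general[where S = "\<lambda>s \<Gamma> \<Delta>. \<exists>r. s = (\<lambda>i. Var (r i)) \<and>
    (\<forall>i < length \<Gamma>. r i < length \<Delta> \<and> ren r (wk (Suc i) (\<Gamma> ! i)) = wk (Suc (r i)) (\<Delta> ! r i))", OF _ _ assms(1)])
  fix s \<Gamma> \<Delta> A j
  assume "\<exists>r. s = (\<lambda>i. Var (r i)) \<and>
    (\<forall>i < length \<Gamma>. r i < length \<Delta> \<and> ren r (wk (Suc i) (\<Gamma> ! i)) = wk (Suc (r i)) (\<Delta> ! r i))"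
  then obtain r where s: "s = (\<lambda>i. Var (r i))"
    and r: "\<And>i. i < length \<Gamma> \<Longrightarrow> r i < length \<Delta> \<and> ren r (wk (Suc i) (\<Gamma> ! i)) = wk (Suc (r i)) (\<Delta> ! r i)"
    by auto
  have "up_ren r i < length (sub s A # \<Delta>) \<and>
      ren (up_ren r) (wk (Suc i) ((A # \<Gamma>) ! i)) = wk (Suc (up_ren r i)) ((sub s A # \<Delta>) ! up_ren r i)"
    if "i < length (A # \<Gamma>)" for i
  proof (cases i)
    case 0
    then show ?thesis
      by (simp add: s flip: ren_eq_sub) (simp add: wk_def ren_ren)
  next
    case (Suc k)
    have "ren (up_ren r) (wk (Suc (Suc k)) (\<Gamma> ! k)) = wk 1 (ren r (wk (Suc k) (\<Gamma> ! k)))"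
      by (simp add: wk_def ren_ren)
    with r[of k] that Suc show ?thesis by simp
  qed
  then show "\<exists>r. up_sub s = (\<lambda>i. Var (r i)) \<and> (\<forall>i < length (A # \<Gamma>). r i < length (sub s A # \<Delta>) \<and>
      ren r (wk (Suc i) ((A # \<Gamma>) ! i)) = wk (Suc (r i)) ((sub s A # \<Delta>) ! r i))"
    by (intro exI[of _ "up_ren r"] conjI allI impI) (simp_all add: s up_sub_Var)
next
  show "\<exists>r'. (\<lambda>i. Var (r i)) = (\<lambda>i. Var (r' i)) \<and>
    (\<forall>i < length \<Gamma>. r' i < length \<Delta> \<and> ren r' (wk (Suc i) (\<Gamma> ! i)) = wk (Suc (r' i)) (\<Delta> ! r' i))"
    using assms(3) by auto
next
  fix s \<Gamma> \<Delta> i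
  assume "\<exists>r. s = (\<lambda>i. Var (r i)) \<and>
    (\<forall>i < length \<Gamma>. r i < length \<Delta> \<and> ren r (wk (Suc i) (\<Gamma> ! i)) = wk (Suc (r i)) (\<Delta> ! r i))"
    and "wf_ctx \<Delta>" "i < length \<Gamma>"
  then show "\<Delta> \<turnstile> s i \<Colon> sub s (wk (Suc i) (\<Gamma> ! i))"
    by (metis ren_eq_sub ty_Var)
qed (fact assms(2))

lemma wf_ctx_has_type: "\<Gamma> \<turnstile> t \<Colon> A \<Longrightarrow> wf_ctx \<Gamma>"
  by (induction rule: wf_ctx_has_type.inducts(2)[where ?P1.0 = "\<lambda>_. True"]) auto

lemma typing_wk:
  assumes "\<Gamma> \<turnstile> t \<Colon> A" "\<Gamma> \<turnstile> B \<Colon> Univ i"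
  shows "B # \<Gamma> \<turnstile> wk 1 t \<Colon> wk 1 A"
proof -
  have "wf_ctx (B # \<Gamma>)"
    using assms by (auto intro: wf_Cons dest: wf_ctx_has_type)
  then show ?thesis
    unfolding wk_def by (rule typing_ren[OF assms(1)]) (simp add: wk_def ren_ren)
qed

lemma typing_sub:
  assumes "\<Gamma> \<turnstile> t \<Colon> A" "wf_ctx \<Delta>" "\<And>i. i < length \<Gamma> \<Longrightarrow> \<Delta> \<turnstile> s i \<Colon> sub s (wk (Suc i) (\<Gamma> ! i))"
  shows "\<Delta> \<turnstile> sub s t \<Colon> sub s A"
proof (rule typing_sub_general[where
    S = "\<lambda>s \<Gamma> \<Delta>. \<forall>i < length \<Gamma>. \<Delta> \<turnstile> s i \<Colon> sub s (wk (Suc i) (\<Gamma> ! i))", OF _ _ assms(1)])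
  fix s \<Gamma> \<Delta> A j
  assume s: "\<forall>i < length \<Gamma>. \<Delta> \<turnstile> s i \<Colon> sub s (wk (Suc i) (\<Gamma> ! i))" and A: "\<Delta> \<turnstile> sub s A \<Colon> Univ j"
  have "sub s A # \<Delta> \<turnstile> up_sub s i \<Colon> sub (up_sub s) (wk (Suc i) ((A # \<Gamma>) ! i))"
    if "i < length (A # \<Gamma>)" for i
  proof (cases i)
    case 0
    have "sub s A # \<Delta> \<turnstile> Var 0 \<Colon> wk (Suc 0) ((sub s A # \<Delta>) ! 0)"
      using A by (intro ty_Var wf_Cons) (auto dest: wf_ctx_has_type)
    with 0 show ?thesis by (simp add: sub_up_wk1)
  next
    case (Suc k)
    then have "sub s A # \<Delta> \<turnstile> wk 1 (s k) \<Colon> wk 1 (sub s (wk (Suc k) (\<Gamma> ! k)))"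
      using s that A by (intro typing_wk) auto
    moreover have "wk 1 (sub s (wk (Suc k) (\<Gamma> ! k))) = sub (up_sub s) (wk (Suc (Suc k)) (\<Gamma> ! k))"
      by (simp add: sub_wk wk_sub)
    ultimately show ?thesis using Suc by simp
  qed
  then show "\<forall>i < length (A # \<Gamma>). sub s A # \<Delta> \<turnstile> up_sub s i \<Colon> sub (up_sub s) (wk (Suc i) ((A # \<Gamma>) ! i))"
    by blast
qed (use assms in auto)

lemma typing_var:
  assumes "wf_ctx \<Gamma>" "i < length \<Gamma>" "wk (Suc i) (\<Gamma> ! i) = A"
  shows "\<Gamma> \<turnstile> Var i \<Colon> A"
  using assms ty_Var by blast

lemma typing_inst:
  assumes "A # \<Gamma> \<turnstile> t \<Colon> B" "\<Gamma> \<turnstile> a \<Colon> A"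
  shows "\<Gamma> \<turnstile> inst t a \<Colon> inst B a"
  unfolding inst_def
proof (rule typing_sub[OF assms(1)])
  show wf: "wf_ctx \<Gamma>"
    using assms(2) by (rule wf_ctx_has_type)
  fix i assume i: "i < length (A # \<Gamma>)"
  \<comment> \<open>Instantiation undoes exactly one weakening: at index 0 the required type is that
    of \<open>a\<close>, and at \<open>Suc k\<close> it is the type of \<open>Var k\<close> in
    \<open>\<Gamma>\<close>.\<close>
  have eq: "sub (case_nat a Var) (wk (Suc i) ((A # \<Gamma>) ! i)) = wk i ((A # \<Gamma>) ! i)" for i
    using inst_wk[of i _ a] by (simp add: inst_def)
  show "\<Gamma> \<turnstile> case_nat a Var i \<Colon> sub (case_nat a Var) (wk (Suc i) ((A # \<Gamma>) ! i))"
    unfolding eq using i assms(2) wf by (cases i) (auto intro: ty_Var)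
qed

section \<open>Inversion for type formers and regularity of typing\<close>

lemma wf_ctx_nth: "wf_ctx \<Gamma> \<Longrightarrow> i < length \<Gamma> \<Longrightarrow> \<exists>j. \<Gamma> \<turnstile> wk (Suc i) (\<Gamma> ! i) \<Colon> Univ j"
proof (induction \<Gamma> arbitrary: i)
  case (Cons A \<Gamma>)
  from Cons.prems(1) obtain k where A: "wf_ctx \<Gamma>" "\<Gamma> \<turnstile> A \<Colon> Univ k"
    by (auto elim: wf_ctx.cases)
  show ?case
  proof (cases i)
    case 0
    then show ?thesis using typing_wk[OF A(2) A(2)] by auto
  next
    case (Suc m)
    with Cons.IH[OF A(1), of m] Cons.prems(2) obtain j where
      "\<Gamma> \<turnstile> wk (Suc m) (\<Gamma> ! m) \<Colon> Univ j" by auto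
    from typing_wk[OF this A(2)] Suc show ?thesis by auto
  qed
qed simp

text \<open>The conversion rule changes the type and keeps the term, so with \<open>T\<close>
  arbitrary the induction passes through conversions down to the formation rule.\<close>

lemma Prd_inversion:
  assumes "\<Gamma> \<turnstile> Prd A B \<Colon> T"
  shows "\<exists>i j. \<Gamma> \<turnstile> A \<Colon> Univ i \<and> A # \<Gamma> \<turnstile> B \<Colon> Univ j"
  using assms by (induction \<Gamma> "Prd A B" T rule: wf_ctx_has_type.inducts(2)[where ?P1.0 = "\<lambda>_. True"]) auto

lemma Sg_inversion:
  assumes "\<Gamma> \<turnstile> Sg A B \<Colon> T"
  shows "\<exists>i j. \<Gamma> \<turnstile> A \<Colon> Univ i \<and> A # \<Gamma> \<turnstile> B \<Colon> Univ j"
  using assms by (induction \<Gamma> "Sg A B" T rule: wf_ctx_has_type.inducts(2)[where ?P1.0 = "\<lambda>_. True"]) auto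

lemma Sm_inversion:
  assumes "\<Gamma> \<turnstile> Sm A B \<Colon> T"
  shows "\<exists>i j. \<Gamma> \<turnstile> A \<Colon> Univ i \<and> \<Gamma> \<turnstile> B \<Colon> Univ j"
  using assms by (induction \<Gamma> "Sm A B" T rule: wf_ctx_has_type.inducts(2)[where ?P1.0 = "\<lambda>_. True"]) auto

lemma Trunc_inversion:
  assumes "\<Gamma> \<turnstile> Trunc A \<Colon> T"
  shows "\<exists>i. \<Gamma> \<turnstile> A \<Colon> Univ i"
  using assms by (induction \<Gamma> "Trunc A" T rule: wf_ctx_has_type.inducts(2)[where ?P1.0 = "\<lambda>_. True"]) auto

lemma Eq_inversion:
  assumes "\<Gamma> \<turnstile> Eq A a b \<Colon> T"
  shows "\<exists>i. \<Gamma> \<turnstile> A \<Colon> Univ i \<and> \<Gamma> \<turnstile> a \<Colon> A \<and> \<Gamma> \<turnstile> b \<Colon> A"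
  using assms by (induction \<Gamma> "Eq A a b" T rule: wf_ctx_has_type.inducts(2)[where ?P1.0 = "\<lambda>_. True"]) auto

text \<open>Rules such as \<open>ty_App\<close> and \<open>ty_J\<close> have no premise saying that
  the type they assign is well formed; this recovers it. An eliminator's type is in most cases its
  motive applied to the scrutinee, so \<open>ty_App\<close> supplies the universe.\<close>

lemma typing_regular: "\<Gamma> \<turnstile> t \<Colon> A \<Longrightarrow> \<exists>i. \<Gamma> \<turnstile> A \<Colon> Univ i"
proof (induction rule: wf_ctx_has_type.inducts(2)[where ?P1.0 = "\<lambda>_. True"])
  case (ty_Var \<Gamma> i)
  then show ?case by (intro wf_ctx_nth)
next
  case (ty_App \<Gamma> f A B a)
  then obtain i j where "A # \<Gamma> \<turnstile> B \<Colon> Univ j"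
    by (meson Prd_inversion)
  from typing_inst[OF this ty_App.hyps(2)] show ?case by (auto simp: inst_def)
next
  case (ty_Split \<Gamma> C A B k g p)
  from wf_ctx_has_type.ty_App[OF ty_Split.hyps(1,3)] show ?case by (auto simp: inst_def)
next
  case (ty_EmpInd \<Gamma> C i k e)
  from ty_App[OF ty_EmpInd.hyps(1,2)] show ?case by (auto simp: inst_def)
next
  case (ty_OneInd \<Gamma> C i k c x)
  from ty_App[OF ty_OneInd.hyps(1,3)] show ?case by (auto simp: inst_def)
next
  case (ty_SumInd \<Gamma> C A B k f g s)
  from ty_App[OF ty_SumInd.hyps(1,4)] show ?case by (auto simp: inst_def)
next
  case (ty_NatInd \<Gamma> C k z s n)
  from ty_App[OF ty_NatInd.hyps(1,4)] show ?case by (auto simp: inst_def)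
next
  case (ty_J \<Gamma> C A k d p a b)
  obtain i where i: "\<Gamma> \<turnstile> Eq A a b \<Colon> Univ i" using ty_J.IH(3) by blast
  then have a: "\<Gamma> \<turnstile> a \<Colon> A" and b: "\<Gamma> \<turnstile> b \<Colon> A" using Eq_inversion by blast+
  have "inst (Prd (wk 1 A) (Prd (Eq (wk 2 A) (Var 1) (Var 0)) (Univ k))) a =
      Prd A (Prd (Eq (wk 1 A) (wk 1 a) (Var 0)) (Univ k))"
    by (simp add: inst_def sub_wk numeral_2_eq_2) (simp add: wk_def ren_eq_sub)
  with ty_App[OF ty_J.hyps(1) a] have "\<Gamma> \<turnstile> App C a \<Colon> Prd A (Prd (Eq (wk 1 A) (wk 1 a) (Var 0)) (Univ k))"
    by simp
  from ty_App[OF this b] have "\<Gamma> \<turnstile> App2 C a b \<Colon> Prd (Eq A a b) (Univ k)"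
    by (simp add: inst_def sub_wk)
  from ty_App[OF this ty_J.hyps(3)] show ?case by (auto simp: inst_def)
next
  case (ty_FunExt \<Gamma> f A B g h)
  then show ?case by (meson wf_ctx_has_type.ty_Eq)
qed (auto intro: typing_rules dest: wf_ctx_has_type)

section \<open>A sound partial type checker\<close>

text \<open>
  Only the beta rule and the iota rules of sums are ever contracted in the types met below. Soundness
  needs no confluence: equality of reducts is only used as a sufficient test for conversion.
\<close>

definition app :: "tm \<Rightarrow> tm \<Rightarrow> tm" where
  "app f a = (case f of Lam A t \<Rightarrow> inst t a | _ \<Rightarrow> App f a)"

definition sum_case :: "tm \<Rightarrow> tm \<Rightarrow> tm \<Rightarrow> tm \<Rightarrow> tm" where
  "sum_case C f g s = (case s of InL a \<Rightarrow> app f a | InR b \<Rightarrow> app g b | _ \<Rightarrow> SumInd C f g s)"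

fun red :: "tm \<Rightarrow> tm" where
  "red (App f a) = app (red f) (red a)"
| "red (SumInd C f g s) = sum_case (red C) (red f) (red g) (red s)"
| "red (Prd A B) = Prd (red A) (red B)"
| "red (Lam A t) = Lam (red A) (red t)"
| "red (Sg A B) = Sg (red A) (red B)"
| "red (Sm A B) = Sm (red A) (red B)"
| "red (InL a) = InL (red a)"
| "red (InR b) = InR (red b)"
| "red (Eq A a b) = Eq (red A) (red a) (red b)"
| "red (Trunc A) = Trunc (red A)"
| "red t = t"

lemma app_conv: "App f a \<approx> app f a"
  by (auto simp: app_def intro: conv.intros split: tm.split)

lemma sum_case_conv: "SumInd C f g s \<approx> sum_case C f g s"
  by (auto simp: sum_case_def intro: conv.intros app_conv split: tm.split)

lemma red_conv: "t \<approx> red t"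
  by (induction t rule: red.induct)
    (auto intro: conv.intros conv_trans[OF cong_App app_conv] conv_trans[OF cong_SumInd sum_case_conv])

text \<open>Equality is tested before each reduction, so the conditional stops the evaluation as
  soon as both sides agree.\<close>

primrec convertible :: "nat \<Rightarrow> tm \<Rightarrow> tm \<Rightarrow> bool" where
  "convertible 0 s t \<longleftrightarrow> s = t"
| "convertible (Suc n) s t \<longleftrightarrow> (if s = t then True else convertible n (red s) (red t))"

lemma convertible_conv: "convertible n s t \<Longrightarrow> s \<approx> t"
proof (induction n arbitrary: s t)
  case (Suc n)
  then show ?case
    by (metis conv_refl conv_sym conv_trans convertible.simps(2) red_conv)
qed (auto intro: conv.intros)

text \<open>Five parallel reduction steps suffice for all types met below.\<close>

definition expect :: "tm option \<Rightarrow> tm \<Rightarrow> tm option" where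
  "expect m S = (case m of None \<Rightarrow> Some S | Some T \<Rightarrow> if convertible 5 S T then Some T else None)"

definition as_Univ :: "tm option \<Rightarrow> nat option" where
  "as_Univ m = (case m of Some (Univ i) \<Rightarrow> Some i | _ \<Rightarrow> None)"

definition as_Prd :: "tm option \<Rightarrow> (tm \<times> tm) option" where
  "as_Prd m = (case m of Some (Prd A B) \<Rightarrow> Some (A, B) | _ \<Rightarrow> None)"

definition as_Sm :: "tm option \<Rightarrow> (tm \<times> tm) option" where
  "as_Sm m = (case m of Some (Sm A B) \<Rightarrow> Some (A, B) | _ \<Rightarrow> None)"

lemma as_Some_iff:
  "as_Univ m = Some i \<longleftrightarrow> m = Some (Univ i)"
  "as_Prd m = Some (A, B) \<longleftrightarrow> m = Some (Prd A B)"
  "as_Sm m = Some (A, B) \<longleftrightarrow> m = Some (Sm A B)"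
  by (auto simp: as_Univ_def as_Prd_def as_Sm_def split: option.split tm.split)

text \<open>Contracting the type of a large elimination makes it usable as a universe.\<close>

fun elim_type :: "tm \<Rightarrow> tm \<Rightarrow> tm" where
  "elim_type (Lam D (Univ i)) s = Univ i"
| "elim_type C s = App C s"

lemma elim_type_typing: "\<Gamma> \<turnstile> t \<Colon> App C s \<Longrightarrow> \<Gamma> \<turnstile> t \<Colon> elim_type C s"
proof (induction C s rule: elim_type.induct)
  case (1 D i s)
  have "App (Lam D (Univ i)) s \<approx> Univ i"
    using beta[of D "Univ i" s] by (simp add: inst_def)
  with 1 show ?case
    by (auto intro: ty_conv ty_Univ dest: wf_ctx_has_type)
qed auto

text \<open>
  \<open>infer t \<Gamma> None\<close> synthesizes a type, \<open>infer t \<Gamma> (Some T)\<close> checks \<open>t\<close> against \<open>T\<close>;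
  in the second case \<open>T\<close> is assumed to be a type. The checker is incomplete: it gives up on all
  constructors it does not treat, and never normalizes a synthesized type.
\<close>

fun infer :: "tm \<Rightarrow> tm list \<Rightarrow> tm option \<Rightarrow> tm option" where
  "infer (Var i) \<Gamma> m = (if i < length \<Gamma> then expect m (wk (Suc i) (\<Gamma> ! i)) else None)"
| "infer (Univ i) \<Gamma> m = expect m (Univ (Suc i))"
| "infer (Emp i) \<Gamma> m = expect m (Univ i)"
| "infer (One i) \<Gamma> m = expect m (Univ i)"
| "infer (Star i) \<Gamma> m = expect m (One i)"
| "infer (Prd A B) \<Gamma> m = (case as_Univ (infer A \<Gamma> None) of None \<Rightarrow> None | Some i \<Rightarrow>
    (case as_Univ (infer B (A # \<Gamma>) None) of None \<Rightarrow> None | Some j \<Rightarrow> expect m (Univ (max i j))))"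
| "infer (Sg A B) \<Gamma> m = (case as_Univ (infer A \<Gamma> None) of None \<Rightarrow> None | Some i \<Rightarrow>
    (case as_Univ (infer B (A # \<Gamma>) None) of None \<Rightarrow> None | Some j \<Rightarrow> expect m (Univ (max i j))))"
| "infer (Sm A B) \<Gamma> m = (case as_Univ (infer A \<Gamma> None) of None \<Rightarrow> None | Some i \<Rightarrow>
    (case as_Univ (infer B \<Gamma> None) of None \<Rightarrow> None | Some j \<Rightarrow> expect m (Univ (max i j))))"
| "infer (Eq A a b) \<Gamma> m = (case as_Univ (infer A \<Gamma> None) of None \<Rightarrow> None | Some i \<Rightarrow>
    (case infer a \<Gamma> (Some A) of None \<Rightarrow> None | Some _ \<Rightarrow>
      (case infer b \<Gamma> (Some A) of None \<Rightarrow> None | Some _ \<Rightarrow> expect m (Univ i))))"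
| "infer (Refl a) \<Gamma> m =
    (case infer a \<Gamma> None of None \<Rightarrow> None | Some A \<Rightarrow> expect m (Eq A a a))"
| "infer (Trunc A) \<Gamma> m =
    (case as_Univ (infer A \<Gamma> None) of None \<Rightarrow> None | Some i \<Rightarrow> expect m (Univ i))"
| "infer (Lam A t) \<Gamma> m = (case as_Univ (infer A \<Gamma> None) of None \<Rightarrow> None | Some i \<Rightarrow>
    (case infer t (A # \<Gamma>) None of None \<Rightarrow> None | Some B \<Rightarrow> expect m (Prd A B)))"
| "infer (App f a) \<Gamma> m = (case as_Prd (infer f \<Gamma> None) of None \<Rightarrow> None | Some (A, B) \<Rightarrow>
    (case infer a \<Gamma> (Some A) of None \<Rightarrow> None | Some _ \<Rightarrow> expect m (inst B a)))"
| "infer (InL a) \<Gamma> m = (case as_Sm m of None \<Rightarrow> None | Some (A, B) \<Rightarrow>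
    (case infer a \<Gamma> (Some A) of None \<Rightarrow> None | Some _ \<Rightarrow> m))"
| "infer (InR b) \<Gamma> m = (case as_Sm m of None \<Rightarrow> None | Some (A, B) \<Rightarrow>
    (case infer b \<Gamma> (Some B) of None \<Rightarrow> None | Some _ \<Rightarrow> m))"
| "infer (SumInd C f g s) \<Gamma> m = (case as_Prd (infer C \<Gamma> None) of None \<Rightarrow> None | Some (S, U) \<Rightarrow>
    (case as_Univ (Some U) of None \<Rightarrow> None | Some k \<Rightarrow>
    (case as_Sm (Some S) of None \<Rightarrow> None | Some (A, B) \<Rightarrow>
    (case infer f \<Gamma> (Some (Prd A (App (wk 1 C) (InL (Var 0))))) of None \<Rightarrow> None | Some _ \<Rightarrow>
    (case infer g \<Gamma> (Some (Prd B (App (wk 1 C) (InR (Var 0))))) of None \<Rightarrow> None | Some _ \<Rightarrow>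
    (case infer s \<Gamma> (Some (Sm A B)) of None \<Rightarrow> None | Some _ \<Rightarrow> expect m (elim_type C s)))))))"
| "infer t \<Gamma> m = None"

lemma expect_sound:
  assumes "\<Gamma> \<turnstile> t \<Colon> S" "expect m S = Some T" "\<And>T. m = Some T \<Longrightarrow> \<exists>i. \<Gamma> \<turnstile> T \<Colon> Univ i"
  shows "\<Gamma> \<turnstile> t \<Colon> T \<and> (m = None \<or> m = Some T)"
  using assms by (auto simp: expect_def split: option.splits if_splits intro: ty_conv convertible_conv)

text \<open>The checker may be run against a type only if that is known to be a type. For the
  branches of a sum elimination this follows from the typing of the motive alone.\<close>

lemma sum_branch_typing:
  assumes C: "\<Gamma> \<turnstile> C \<Colon> Prd (Sm A B) (Univ k)"
  shows "\<exists>i. \<Gamma> \<turnstile> Prd A (App (wk 1 C) (InL (Var 0))) \<Colon> Univ i"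
    and "\<exists>i. \<Gamma> \<turnstile> Prd B (App (wk 1 C) (InR (Var 0))) \<Colon> Univ i"
proof -
  from C obtain i j where A: "\<Gamma> \<turnstile> A \<Colon> Univ i" and B: "\<Gamma> \<turnstile> B \<Colon> Univ j"
    by (meson Prd_inversion Sm_inversion typing_regular)
  have wk: "wk 1 (Prd (Sm A B) (Univ k)) = Prd (Sm (wk 1 A) (wk 1 B)) (Univ k)" "wk 1 (Univ i) = Univ i" for i
    by (simp_all add: wk_def)
  have var: "D # \<Gamma> \<turnstile> Var 0 \<Colon> wk 1 D" if "\<Gamma> \<turnstile> D \<Colon> Univ k" for D k
    using that by (intro typing_var) (auto intro: wf_Cons dest: wf_ctx_has_type)
  have "A # \<Gamma> \<turnstile> App (wk 1 C) (InL (Var 0)) \<Colon> inst (Univ k) (InL (Var 0))"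
    using typing_wk[OF C A] typing_wk[OF A A] typing_wk[OF B A] var[OF A]
    unfolding wk by (auto intro!: ty_App ty_InL)
  then show "\<exists>i. \<Gamma> \<turnstile> Prd A (App (wk 1 C) (InL (Var 0))) \<Colon> Univ i"
    using A by (auto simp: inst_def intro: ty_Prd)
  have "B # \<Gamma> \<turnstile> App (wk 1 C) (InR (Var 0)) \<Colon> inst (Univ k) (InR (Var 0))"
    using typing_wk[OF C B] typing_wk[OF A B] typing_wk[OF B B] var[OF B]
    unfolding wk by (auto intro!: ty_App ty_InR)
  then show "\<exists>i. \<Gamma> \<turnstile> Prd B (App (wk 1 C) (InR (Var 0))) \<Colon> Univ i"
    using B by (auto simp: inst_def intro: ty_Prd)
qed

text \<open>The second conjunct says that in checking mode the returned type is the requested one;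
  through it the induction hypothesis for a checked subterm gives a typing at exactly that type.
  Universes of synthesized types come from \<open>typing_regular\<close>.\<close>

theorem infer_sound:
  assumes "infer t \<Gamma> m = Some T" "wf_ctx \<Gamma>" "\<And>T. m = Some T \<Longrightarrow> \<exists>i. \<Gamma> \<turnstile> T \<Colon> Univ i"
  shows "\<Gamma> \<turnstile> t \<Colon> T \<and> (m = None \<or> m = Some T)"
  using assms
proof (induction t \<Gamma> m arbitrary: T rule: infer.induct)
  case (1 i \<Gamma> m)
  then show ?case by (intro expect_sound[OF ty_Var]) (auto split: if_splits)
next
  case (6 A B \<Gamma> m)
  from "6.prems"(1) obtain i j where A: "infer A \<Gamma> None = Some (Univ i)"
    and B: "infer B (A # \<Gamma>) None = Some (Univ j)" and T: "expect m (Univ (max i j)) = Some T"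
    by (auto simp: as_Some_iff split: option.splits)
  have A': "\<Gamma> \<turnstile> A \<Colon> Univ i"
    using "6.IH"(1)[OF A "6.prems"(2)] by simp
  moreover have "A # \<Gamma> \<turnstile> B \<Colon> Univ j"
    using "6.IH"(2)[OF _ B] A A' "6.prems"(2) by (simp add: as_Some_iff wf_Cons)
  ultimately show ?case
    using "6.prems"(3) by (auto intro!: expect_sound[OF _ T] ty_Prd)
next
  case (7 A B \<Gamma> m)
  from "7.prems"(1) obtain i j where A: "infer A \<Gamma> None = Some (Univ i)"
    and B: "infer B (A # \<Gamma>) None = Some (Univ j)" and T: "expect m (Univ (max i j)) = Some T"
    by (auto simp: as_Some_iff split: option.splits)
  have A': "\<Gamma> \<turnstile> A \<Colon> Univ i"
    using "7.IH"(1)[OF A "7.prems"(2)] by simp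
  moreover have "A # \<Gamma> \<turnstile> B \<Colon> Univ j"
    using "7.IH"(2)[OF _ B] A A' "7.prems"(2) by (simp add: as_Some_iff wf_Cons)
  ultimately show ?case
    using "7.prems"(3) by (auto intro!: expect_sound[OF _ T] ty_Sg)
next
  case (8 A B \<Gamma> m)
  from "8.prems"(1) obtain i j where A: "infer A \<Gamma> None = Some (Univ i)"
    and B: "infer B \<Gamma> None = Some (Univ j)" and T: "expect m (Univ (max i j)) = Some T"
    by (auto simp: as_Some_iff split: option.splits)
  have A': "\<Gamma> \<turnstile> A \<Colon> Univ i"
    using "8.IH"(1)[OF A "8.prems"(2)] by simp
  moreover have "\<Gamma> \<turnstile> B \<Colon> Univ j"
    using "8.IH"(2)[OF _ B] A A' "8.prems"(2) by (simp add: as_Some_iff wf_Cons)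
  ultimately show ?case
    using "8.prems"(3) by (auto intro!: expect_sound[OF _ T] ty_Sm)
next
  case (9 A a b \<Gamma> m)
  from "9.prems"(1) obtain i A1 A2 where A: "infer A \<Gamma> None = Some (Univ i)"
    and a: "infer a \<Gamma> (Some A) = Some A1" and b: "infer b \<Gamma> (Some A) = Some A2"
    and T: "expect m (Univ i) = Some T"
    by (auto simp: as_Some_iff split: option.splits)
  have A': "\<Gamma> \<turnstile> A \<Colon> Univ i"
    using "9.IH"(1)[OF A "9.prems"(2)] by simp
  moreover have "\<Gamma> \<turnstile> a \<Colon> A"
    using "9.IH"(2)[OF _ a "9.prems"(2)] A A' by (auto simp: as_Some_iff)
  moreover have "\<Gamma> \<turnstile> b \<Colon> A"
    using "9.IH"(3)[OF _ a b "9.prems"(2)] A A' by (auto simp: as_Some_iff)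
  ultimately show ?case
    using "9.prems"(3) by (auto intro!: expect_sound[OF _ T] ty_Eq)
next
  case (10 a \<Gamma> m)
  from "10.prems"(1) obtain A where a: "infer a \<Gamma> None = Some A" and T: "expect m (Eq A a a) = Some T"
    by (auto split: option.splits)
  have a': "\<Gamma> \<turnstile> a \<Colon> A"
    using "10.IH"[OF a "10.prems"(2)] by simp
  then obtain i where "\<Gamma> \<turnstile> A \<Colon> Univ i"
    using typing_regular by blast
  with a' show ?case
    using "10.prems"(3) by (auto intro!: expect_sound[OF _ T] ty_Refl)
next
  case (11 A \<Gamma> m)
  from "11.prems"(1) obtain i where A: "infer A \<Gamma> None = Some (Univ i)" and T: "expect m (Univ i) = Some T"
    by (auto simp: as_Some_iff split: option.splits)
  show ?case
    using "11.IH"[OF A "11.prems"(2)] "11.prems"(3) by (auto intro!: expect_sound[OF _ T] ty_Trunc)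
next
  case (12 A t \<Gamma> m)
  from "12.prems"(1) obtain i B where A: "infer A \<Gamma> None = Some (Univ i)"
    and t: "infer t (A # \<Gamma>) None = Some B" and T: "expect m (Prd A B) = Some T"
    by (auto simp: as_Some_iff split: option.splits)
  have A': "\<Gamma> \<turnstile> A \<Colon> Univ i"
    using "12.IH"(1)[OF A "12.prems"(2)] by simp
  have t': "A # \<Gamma> \<turnstile> t \<Colon> B"
    using "12.IH"(2)[OF _ t] A A' "12.prems"(2) by (simp add: as_Some_iff wf_Cons)
  then obtain j where "A # \<Gamma> \<turnstile> B \<Colon> Univ j"
    using typing_regular by blast
  with A' t' show ?case
    using "12.prems"(3) by (auto intro!: expect_sound[OF _ T] ty_Lam)
next
  case (13 f a \<Gamma> m)
  from "13.prems"(1) obtain A B A1 where f: "infer f \<Gamma> None = Some (Prd A B)"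
    and a: "infer a \<Gamma> (Some A) = Some A1" and T: "expect m (inst B a) = Some T"
    by (auto simp: as_Some_iff split: option.splits)
  have f': "\<Gamma> \<turnstile> f \<Colon> Prd A B"
    using "13.IH"(1)[OF f "13.prems"(2)] by simp
  then obtain i where "\<Gamma> \<turnstile> A \<Colon> Univ i"
    using Prd_inversion typing_regular by blast
  then have "\<Gamma> \<turnstile> a \<Colon> A"
    using "13.IH"(2)[OF _ refl a "13.prems"(2)] f by (auto simp: as_Some_iff)
  with f' show ?case
    using "13.prems"(3) by (auto intro!: expect_sound[OF _ T] ty_App)
next
  case (14 a \<Gamma> m)
  from "14.prems"(1) obtain A B A1 where m: "m = Some (Sm A B)" "T = Sm A B"
    and a: "infer a \<Gamma> (Some A) = Some A1"
    by (auto simp: as_Some_iff split: option.splits)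
  obtain i j where AB: "\<Gamma> \<turnstile> A \<Colon> Univ i" "\<Gamma> \<turnstile> B \<Colon> Univ j"
    using "14.prems"(3)[OF m(1)] Sm_inversion by blast
  then have "\<Gamma> \<turnstile> a \<Colon> A"
    using "14.IH"[OF _ refl a "14.prems"(2)] m by (auto simp: as_Some_iff)
  with AB m show ?case by (auto intro: ty_InL)
next
  case (15 b \<Gamma> m)
  from "15.prems"(1) obtain A B B1 where m: "m = Some (Sm A B)" "T = Sm A B"
    and b: "infer b \<Gamma> (Some B) = Some B1"
    by (auto simp: as_Some_iff split: option.splits)
  obtain i j where AB: "\<Gamma> \<turnstile> A \<Colon> Univ i" "\<Gamma> \<turnstile> B \<Colon> Univ j"
    using "15.prems"(3)[OF m(1)] Sm_inversion by blast
  then have "\<Gamma> \<turnstile> b \<Colon> B"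
    using "15.IH"[OF _ refl b "15.prems"(2)] m by (auto simp: as_Some_iff)
  with AB m show ?case by (auto intro: ty_InR)
next
  case (16 C f g s \<Gamma> m)
  from "16.prems"(1) obtain A B k F G S where C: "infer C \<Gamma> None = Some (Prd (Sm A B) (Univ k))"
    and f: "infer f \<Gamma> (Some (Prd A (App (wk 1 C) (InL (Var 0))))) = Some F"
    and g: "infer g \<Gamma> (Some (Prd B (App (wk 1 C) (InR (Var 0))))) = Some G"
    and s: "infer s \<Gamma> (Some (Sm A B)) = Some S" and T: "expect m (elim_type C s) = Some T"
    by (auto simp: as_Some_iff split: option.splits)
  note eqs = C as_Some_iff
  have C': "\<Gamma> \<turnstile> C \<Colon> Prd (Sm A B) (Univ k)"
    using "16.IH"(1)[OF C "16.prems"(2)] by simp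
  note branch = sum_branch_typing[OF this]
  have "\<exists>i. \<Gamma> \<turnstile> Sm A B \<Colon> Univ i"
    using C' Prd_inversion typing_regular by blast
  then have "\<Gamma> \<turnstile> s \<Colon> Sm A B"
    using "16.IH"(4)[OF _ refl _ _ refl f g s "16.prems"(2)] by (auto simp: eqs)
  moreover have "\<Gamma> \<turnstile> f \<Colon> Prd A (App (wk 1 C) (InL (Var 0)))"
    using "16.IH"(2)[OF _ refl _ _ refl f "16.prems"(2)] branch(1) by (auto simp: eqs)
  moreover have "\<Gamma> \<turnstile> g \<Colon> Prd B (App (wk 1 C) (InR (Var 0)))"
    using "16.IH"(3)[OF _ refl _ _ refl f g "16.prems"(2)] branch(2) by (auto simp: eqs)
  ultimately show ?case
    using C' "16.prems"(3) by (auto intro!: expect_sound[OF _ T] elim_type_typing ty_SumInd)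
next
  case (2 i \<Gamma> m)
  then show ?case by (intro expect_sound[OF ty_Univ]) auto
next
  case (3 i \<Gamma> m)
  then show ?case by (intro expect_sound[OF ty_Emp]) auto
next
  case (4 i \<Gamma> m)
  then show ?case by (intro expect_sound[OF ty_One]) auto
next
  case (5 i \<Gamma> m)
  then show ?case by (intro expect_sound[OF ty_Star]) auto
qed auto

section \<open>Inhabitation as a sequent calculus\<close>

text \<open>
  Well-formedness of the sequent is a hypothesis, so that rules applied backwards leave no typing
  obligations; only the cut formula and the result of a conversion have to be checked.
\<close>

definition provable :: "tm list \<Rightarrow> tm \<Rightarrow> bool" (infix "\<tturnstile>" 50) where
  "\<Gamma> \<tturnstile> T \<longleftrightarrow> (wf_ctx \<Gamma> \<longrightarrow> (\<exists>i. \<Gamma> \<turnstile> T \<Colon> Univ i) \<longrightarrow> (\<exists>t. \<Gamma> \<turnstile> t \<Colon> T))"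

abbreviation is_type :: "tm list \<Rightarrow> tm \<Rightarrow> bool" where
  "is_type \<Gamma> T \<equiv> as_Univ (infer T \<Gamma> None) \<noteq> None"

lemma is_type_sound: "is_type \<Gamma> T \<Longrightarrow> wf_ctx \<Gamma> \<Longrightarrow> \<exists>i. \<Gamma> \<turnstile> T \<Colon> Univ i"
  using infer_sound by (fastforce simp: as_Some_iff)

lemma infer_None_sound: "infer t \<Gamma> None = Some T \<Longrightarrow> wf_ctx \<Gamma> \<Longrightarrow> \<Gamma> \<turnstile> t \<Colon> T"
  using infer_sound by fastforce

lemma infer_Some_sound:
  assumes "infer t \<Gamma> (Some T) \<noteq> None" "wf_ctx \<Gamma>" "\<Gamma> \<turnstile> T \<Colon> Univ i"
  shows "\<Gamma> \<turnstile> t \<Colon> T"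
  using infer_sound[of t \<Gamma> "Some T"] assms by auto

lemma provable_infer: "infer t \<Gamma> (Some T) \<noteq> None \<Longrightarrow> \<Gamma> \<tturnstile> T"
  unfolding provable_def using infer_Some_sound by blast

lemma provable_conv:
  assumes "T \<approx> T'" "is_type \<Gamma> T'" "\<Gamma> \<tturnstile> T'"
  shows "\<Gamma> \<tturnstile> T"
  using assms is_type_sound unfolding provable_def by (meson conv_sym ty_conv)

lemma provable_Prd: "A # \<Gamma> \<tturnstile> B \<Longrightarrow> \<Gamma> \<tturnstile> Prd A B"
  unfolding provable_def by (meson Prd_inversion ty_Lam wf_Cons)

lemma provable_Sg:
  assumes "infer a \<Gamma> (Some A) \<noteq> None" "\<Gamma> \<tturnstile> inst B a"
  shows "\<Gamma> \<tturnstile> Sg A B"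
  unfolding provable_def
proof (intro impI)
  assume wf: "wf_ctx \<Gamma>" and "\<exists>i. \<Gamma> \<turnstile> Sg A B \<Colon> Univ i"
  then obtain i j where A: "\<Gamma> \<turnstile> A \<Colon> Univ i" and B: "A # \<Gamma> \<turnstile> B \<Colon> Univ j"
    by (meson Sg_inversion)
  have a: "\<Gamma> \<turnstile> a \<Colon> A" using infer_Some_sound assms(1) wf A by blast
  from typing_inst[OF B a] have "\<Gamma> \<turnstile> inst B a \<Colon> Univ j" by (simp add: inst_def)
  then show "\<exists>t. \<Gamma> \<turnstile> t \<Colon> Sg A B"
    using assms(2) wf A B a unfolding provable_def by (meson ty_Pr)
qed

text \<open>
  The first premise says that \<open>B\<close> does not depend on its bound variable; \<open>Univ 0\<close> is a dummy.
\<close>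

lemma provable_Prod:
  assumes "wk 1 (inst B (Univ 0)) = B" "\<Gamma> \<tturnstile> A" "\<Gamma> \<tturnstile> inst B (Univ 0)"
  shows "\<Gamma> \<tturnstile> Sg A B"
  unfolding provable_def
proof (intro impI)
  assume wf: "wf_ctx \<Gamma>" and "\<exists>i. \<Gamma> \<turnstile> Sg A B \<Colon> Univ i"
  then obtain i j where A: "\<Gamma> \<turnstile> A \<Colon> Univ i" and B: "A # \<Gamma> \<turnstile> B \<Colon> Univ j"
    by (meson Sg_inversion)
  obtain a where a: "\<Gamma> \<turnstile> a \<Colon> A" using assms(2) wf A unfolding provable_def by blast
  have eq: "inst B a = inst B (Univ 0)"
    by (subst assms(1)[symmetric]) simp
  from typing_inst[OF B a] have "\<Gamma> \<turnstile> inst B (Univ 0) \<Colon> Univ j" by (simp add: eq) (simp add: inst_def)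
  then show "\<exists>t. \<Gamma> \<turnstile> t \<Colon> Sg A B"
    using assms(3) wf A B a unfolding provable_def by (metis eq ty_Pr)
qed

text \<open>Cut is instantiation: the term over \<open>A # \<Gamma>\<close> is instantiated at
  \<open>a\<close>, which cancels the weakening of \<open>T\<close>. The first premise is phrased to
  cover both an explicit term and a provable type.\<close>

lemma provable_cut_typing:
  assumes "wf_ctx \<Gamma> \<Longrightarrow> \<exists>a. \<Gamma> \<turnstile> a \<Colon> A" "A # \<Gamma> \<tturnstile> wk 1 T"
  shows "\<Gamma> \<tturnstile> T"
  unfolding provable_def
proof (intro impI, elim exE)
  fix i assume wf: "wf_ctx \<Gamma>" and T: "\<Gamma> \<turnstile> T \<Colon> Univ i"
  obtain a j where a: "\<Gamma> \<turnstile> a \<Colon> A" and A: "\<Gamma> \<turnstile> A \<Colon> Univ j"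
    using assms(1)[OF wf] typing_regular by blast
  from typing_wk[OF T A] obtain t where "A # \<Gamma> \<turnstile> t \<Colon> wk 1 T"
    using assms(2) wf A wf_Cons unfolding provable_def by fastforce
  from typing_inst[OF this a] show "\<exists>t. \<Gamma> \<turnstile> t \<Colon> T" by auto
qed

lemma provable_cut_term: "infer a \<Gamma> None = Some A \<Longrightarrow> A # \<Gamma> \<tturnstile> wk 1 T \<Longrightarrow> \<Gamma> \<tturnstile> T"
  by (rule provable_cut_typing) (auto dest: infer_None_sound)

lemma provable_cut:
  assumes "is_type \<Gamma> A" "\<Gamma> \<tturnstile> A" "A # \<Gamma> \<tturnstile> wk 1 T"
  shows "\<Gamma> \<tturnstile> T"
proof (rule provable_cut_typing[OF _ assms(3)])
  assume "wf_ctx \<Gamma>"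
  then show "\<exists>a. \<Gamma> \<turnstile> a \<Colon> A"
    using is_type_sound[OF assms(1)] assms(2) unfolding provable_def by blast
qed

lemma provable_Trunc: "\<Gamma> \<tturnstile> A \<Longrightarrow> \<Gamma> \<tturnstile> Trunc A"
  unfolding provable_def by (meson Trunc_inversion ty_TIn)

lemma inst_wk1 [simp]: "inst (wk (Suc 0) t) a = t"
  using inst_wk[of 0] by simp

lemma provable_Trunc_elim:
  assumes "infer x \<Gamma> None = Some (Trunc A)" "\<Gamma> \<tturnstile> IsProp P" "A # \<Gamma> \<tturnstile> wk 1 P"
  shows "\<Gamma> \<tturnstile> P"
  unfolding provable_def
proof (intro impI, elim exE)
  fix i assume wf: "wf_ctx \<Gamma>" and P: "\<Gamma> \<turnstile> P \<Colon> Univ i"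
  have x: "\<Gamma> \<turnstile> x \<Colon> Trunc A"
    using infer_None_sound assms(1) wf by blast
  then obtain j where A: "\<Gamma> \<turnstile> A \<Colon> Univ j"
    using Trunc_inversion typing_regular by blast
  from typing_wk[OF P A] have P': "A # \<Gamma> \<turnstile> wk 1 P \<Colon> Univ i" by simp
  then obtain t where t: "A # \<Gamma> \<turnstile> t \<Colon> wk 1 P"
    using assms(3) wf A wf_Cons unfolding provable_def by blast
  \<comment> \<open>\<open>provable\<close> yields a term only at a well-formed type, so
    \<open>IsProp P\<close> has to be typed before its proof can be extracted.\<close>
  have PP: "P # \<Gamma> \<turnstile> wk 1 P \<Colon> Univ i"
    using typing_wk[OF P P] by simp
  have PPP: "wk 1 P # P # \<Gamma> \<turnstile> wk 2 P \<Colon> Univ i"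
    using typing_wk[OF PP PP] by (simp add: numeral_2_eq_2)
  have "wk 1 P # P # \<Gamma> \<turnstile> Var 0 \<Colon> wk 2 P" "wk 1 P # P # \<Gamma> \<turnstile> Var 1 \<Colon> wk 2 P"
    using wf P PP by (auto intro!: typing_var wf_Cons simp: numeral_2_eq_2)
  from ty_Prd[OF P ty_Prd[OF PP ty_Eq[OF PPP this(2,1)]]] have "\<exists>j. \<Gamma> \<turnstile> IsProp P \<Colon> Univ j"
    unfolding IsProp_def by blast
  then obtain h where "\<Gamma> \<turnstile> h \<Colon> IsProp P"
    using assms(2) wf unfolding provable_def by blast
  moreover have "\<Gamma> \<turnstile> Lam A t \<Colon> Arr A P"
    unfolding Arr_def using A P' t by (rule ty_Lam)
  ultimately show "\<exists>t. \<Gamma> \<turnstile> t \<Colon> P"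
    using P x ty_TRec by blast
qed

lemma provable_Emp_elim:
  assumes "infer e \<Gamma> (Some (Emp l)) \<noteq> None"
  shows "\<Gamma> \<tturnstile> P"
  unfolding provable_def
proof (intro impI, elim exE)
  fix i assume wf: "wf_ctx \<Gamma>" and P: "\<Gamma> \<turnstile> P \<Colon> Univ i"
  have E: "\<Gamma> \<turnstile> Emp l \<Colon> Univ l" using wf by (rule ty_Emp)
  have e: "\<Gamma> \<turnstile> e \<Colon> Emp l"
    using infer_Some_sound[OF assms wf E] .
  have "Emp l # \<Gamma> \<turnstile> wk 1 P \<Colon> Univ i" "Emp l # \<Gamma> \<turnstile> Univ i \<Colon> Univ (Suc i)"
    using typing_wk[OF P E] wf_Cons[OF wf E] by (auto intro: ty_Univ)
  then have "\<Gamma> \<turnstile> EmpInd (Lam (Emp l) (wk 1 P)) e \<Colon> App (Lam (Emp l) (wk 1 P)) e"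
    using E e by (auto intro!: ty_EmpInd ty_Lam)
  moreover have "App (Lam (Emp l) (wk 1 P)) e \<approx> P"
    using beta[of "Emp l" "wk 1 P" e] by simp
  ultimately show "\<exists>t. \<Gamma> \<turnstile> t \<Colon> P"
    using P ty_conv by blast
qed

text \<open>Weakening under a binder and then instantiating is one substitution. This combination
  arises whenever a function or motive is weakened past new hypotheses and then applied.\<close>

lemma inst_ren_up: "inst (ren (up_ren r) t) a = sub (case_nat a (\<lambda>i. Var (r i))) t"
proof -
  have "case_nat a Var (up_ren r i) = case_nat a (\<lambda>i. Var (r i)) i" for i
    by (cases i) simp_all
  then show ?thesis by (simp add: inst_def sub_ren)
qed

lemma case_nat_Var: "case_nat (Var 0) (\<lambda>i. Var (Suc i)) = Var"
  by (rule ext) (simp split: nat.split)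

lemma provable_FunExt:
  assumes "A # \<Gamma> \<tturnstile> Eq B (App (wk 1 f) (Var 0)) (App (wk 1 g) (Var 0))"
  shows "\<Gamma> \<tturnstile> Eq (Prd A B) f g"
  unfolding provable_def
proof (intro impI, elim exE)
  fix i assume wf: "wf_ctx \<Gamma>" and "\<Gamma> \<turnstile> Eq (Prd A B) f g \<Colon> Univ i"
  then obtain j k where f: "\<Gamma> \<turnstile> f \<Colon> Prd A B" and g: "\<Gamma> \<turnstile> g \<Colon> Prd A B"
    and A: "\<Gamma> \<turnstile> A \<Colon> Univ j" and B: "A # \<Gamma> \<turnstile> B \<Colon> Univ k"
    by (meson Eq_inversion Prd_inversion)
  have wf': "wf_ctx (A # \<Gamma>)" using wf A by (rule wf_Cons)
  have v: "A # \<Gamma> \<turnstile> Var 0 \<Colon> wk 1 A" using wf' by (intro typing_var) auto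
  \<comment> \<open>The type is \<open>B\<close> again because weakening under the binder, followed
    by instantiation at \<open>Var 0\<close>, is the identity.\<close>
  have "A # \<Gamma> \<turnstile> App (wk 1 h) (Var 0) \<Colon> B" if "\<Gamma> \<turnstile> h \<Colon> Prd A B" for h
  proof -
    have "A # \<Gamma> \<turnstile> wk 1 h \<Colon> Prd (wk 1 A) (ren (up_ren (\<lambda>i. i + 1)) B)"
      using typing_wk[OF that A] by (simp add: wk_def)
    from ty_App[OF this v] show ?thesis by (simp add: inst_ren_up case_nat_Var)
  qed
  from ty_Eq[OF B this[OF f] this[OF g]] obtain h where
    "A # \<Gamma> \<turnstile> h \<Colon> Eq B (App (wk 1 f) (Var 0)) (App (wk 1 g) (Var 0))"
    using assms wf' unfolding provable_def by blast
  with ty_Eq[OF B] f g A B show "\<exists>t. \<Gamma> \<turnstile> t \<Colon> Eq (Prd A B) f g"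
    by (meson ty_FunExt ty_Lam typing_regular)
qed

lemma provable_Refl: "\<Gamma> \<tturnstile> Eq A a a"
  unfolding provable_def using Eq_inversion ty_Refl by blast

section \<open>Left rules for the unit type, sums and pairs\<close>

lemma typing_wk_append:
  assumes "\<Gamma> \<turnstile> t \<Colon> A" "wf_ctx (\<Delta> @ \<Gamma>)" "n = length \<Delta>"
  shows "\<Delta> @ \<Gamma> \<turnstile> wk n t \<Colon> wk n A"
  unfolding wk_def
  by (rule typing_ren[OF assms(1,2)]) (simp add: wk_def ren_ren assms(3) nth_append ac_simps)

text \<open>The hypothesis of type \<open>D\<close> is replaced by a term over a context extended by
  \<open>\<Delta>\<close>: one new variable for sums, two for pairs.\<close>

lemma typing_sub_append:
  assumes "D # \<Gamma> \<turnstile> t \<Colon> T" "\<Delta> @ \<Gamma> \<turnstile> a \<Colon> wk n D" "n = length \<Delta>"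
  shows "\<Delta> @ \<Gamma> \<turnstile> sub (case_nat a (\<lambda>i. Var (i + n))) t \<Colon> sub (case_nat a (\<lambda>i. Var (i + n))) T"
proof (rule typing_sub[OF assms(1)])
  show wf: "wf_ctx (\<Delta> @ \<Gamma>)" using assms(2) by (rule wf_ctx_has_type)
  fix i assume "i < length (D # \<Gamma>)"
  moreover have "sub (case_nat a (\<lambda>i. Var (i + n))) (wk (Suc i) t) = wk (i + n) t" for i t
    by (simp add: sub_wk) (simp add: wk_def ren_eq_sub add.assoc)
  ultimately show "\<Delta> @ \<Gamma> \<turnstile> case_nat a (\<lambda>i. Var (i + n)) i \<Colon>
      sub (case_nat a (\<lambda>i. Var (i + n))) (wk (Suc i) ((D # \<Gamma>) ! i))"
    using wf assms(2,3) by (cases i) (auto intro!: typing_var simp: nth_append)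
qed

lemma wk_Lam_conv: "App (wk n (Lam D T)) a \<approx> sub (case_nat a (\<lambda>i. Var (i + n))) T"
proof -
  have "App (wk n (Lam D T)) a = App (Lam (wk n D) (ren (up_ren (\<lambda>i. i + n)) T)) a"
    by (simp add: wk_def)
  then show ?thesis using beta[of "wk n D" "ren (up_ren (\<lambda>i. i + n)) T" a] by (simp add: inst_ren_up)
qed

lemma wk_Lam_Var_conv: "App (wk 1 (Lam D T)) (Var 0) \<approx> T"
  using wk_Lam_conv[of 1 D T "Var 0"] by (simp add: case_nat_Var)

lemma typing_family:
  assumes "D # \<Gamma> \<turnstile> T \<Colon> Univ k"
  shows "\<Gamma> \<turnstile> Lam D T \<Colon> Prd D (Univ k)"
proof -
  have wf: "wf_ctx (D # \<Gamma>)" using assms by (rule wf_ctx_has_type)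
  then obtain i where "\<Gamma> \<turnstile> D \<Colon> Univ i" by (auto elim: wf_ctx.cases)
  then show ?thesis using ty_Univ[OF wf] assms by (rule ty_Lam)
qed

text \<open>The motive is the goal abstracted over the hypothesis. It is formed in
  \<open>\<Gamma>\<close> and weakened back, so that the eliminator at \<open>Var 0\<close> has a
  type convertible with \<open>T\<close>. The same scheme gives the rules for sums and pairs; all of
  them act on the innermost hypothesis, on which no other hypothesis depends.\<close>

lemma provable_One_left:
  assumes "\<Gamma> \<tturnstile> inst T (Star l)"
  shows "One l # \<Gamma> \<tturnstile> T"
  unfolding provable_def
proof (intro impI, elim exE)
  fix k assume wf': "wf_ctx (One l # \<Gamma>)" and T: "One l # \<Gamma> \<turnstile> T \<Colon> Univ k"
  then have wf: "wf_ctx \<Gamma>" and O: "\<Gamma> \<turnstile> One l \<Colon> Univ l"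
    by (auto elim: wf_ctx.cases intro: ty_One)
  have C: "\<Gamma> \<turnstile> Lam (One l) T \<Colon> Prd (One l) (Univ k)" using T by (rule typing_family)
  have S: "\<Gamma> \<turnstile> Star l \<Colon> One l" using wf by (rule ty_Star)
  from typing_inst[OF T S] have "\<Gamma> \<turnstile> inst T (Star l) \<Colon> Univ k" by (simp add: inst_def)
  then obtain t where "\<Gamma> \<turnstile> t \<Colon> inst T (Star l)"
    using assms wf unfolding provable_def by blast
  moreover have "\<Gamma> \<turnstile> App (Lam (One l) T) (Star l) \<Colon> Univ k"
    using ty_App[OF C S] by (simp add: inst_def)
  ultimately have "\<Gamma> \<turnstile> t \<Colon> App (Lam (One l) T) (Star l)"
    using beta conv_sym ty_conv by blast
  from typing_wk[OF this O] typing_wk[OF C O]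
  have "One l # \<Gamma> \<turnstile> OneInd (wk 1 (Lam (One l) T)) (wk 1 t) (Var 0) \<Colon> App (wk 1 (Lam (One l) T)) (Var 0)"
    using wf' by (intro ty_OneInd typing_var) (simp_all add: wk_def)
  then show "\<exists>t. One l # \<Gamma> \<turnstile> t \<Colon> T"
    using T wk_Lam_Var_conv ty_conv by blast
qed

text \<open>One hypothesis is replaced by one, so all other indices in the goal stay as they
  are.\<close>

lemma provable_Sm_left:
  assumes "A # \<Gamma> \<tturnstile> sub (case_nat (InL (Var 0)) (\<lambda>i. Var (i + 1))) T"
    and "B # \<Gamma> \<tturnstile> sub (case_nat (InR (Var 0)) (\<lambda>i. Var (i + 1))) T"
  shows "Sm A B # \<Gamma> \<tturnstile> T"
  unfolding provable_def
proof (intro impI, elim exE)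
  fix k assume wf': "wf_ctx (Sm A B # \<Gamma>)" and T: "Sm A B # \<Gamma> \<turnstile> T \<Colon> Univ k"
  then obtain l where wf: "wf_ctx \<Gamma>" and S: "\<Gamma> \<turnstile> Sm A B \<Colon> Univ l"
    by (auto elim: wf_ctx.cases)
  then obtain i j where A: "\<Gamma> \<turnstile> A \<Colon> Univ i" and B: "\<Gamma> \<turnstile> B \<Colon> Univ j"
    using Sm_inversion by blast
  let ?C = "Lam (Sm A B) T"
  have C: "\<Gamma> \<turnstile> ?C \<Colon> Prd (Sm A B) (Univ k)" using T by (rule typing_family)
  have wk_Sm: "wk n (Sm A B) = Sm (wk n A) (wk n B)" for n by (simp add: wk_def)
  have branch: "\<exists>f. \<Gamma> \<turnstile> f \<Colon> Prd D (App (wk 1 ?C) a)"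
    if D: "\<Gamma> \<turnstile> D \<Colon> Univ d" and a: "D # \<Gamma> \<turnstile> a \<Colon> wk 1 (Sm A B)"
      and ex: "\<exists>i. \<Gamma> \<turnstile> Prd D (App (wk 1 ?C) a) \<Colon> Univ i"
      and P: "D # \<Gamma> \<tturnstile> sub (case_nat a (\<lambda>i. Var (i + 1))) T" for D d a
  proof -
    have "D # \<Gamma> \<turnstile> sub (case_nat a (\<lambda>i. Var (i + 1))) T \<Colon> Univ k"
      using typing_sub_append[of _ _ _ _ "[D]", OF T _ refl] a by simp
    then obtain t where "D # \<Gamma> \<turnstile> t \<Colon> sub (case_nat a (\<lambda>i. Var (i + 1))) T"
      using P wf_Cons[OF wf D] unfolding provable_def by blast
    moreover obtain j where j: "D # \<Gamma> \<turnstile> App (wk 1 ?C) a \<Colon> Univ j"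
      using ex Prd_inversion by blast
    ultimately have "D # \<Gamma> \<turnstile> t \<Colon> App (wk 1 ?C) a"
      using wk_Lam_conv conv_sym ty_conv by blast
    then show ?thesis using ty_Lam[OF D j] by blast
  qed
  have var: "D # \<Gamma> \<turnstile> Var 0 \<Colon> wk 1 D" if "\<Gamma> \<turnstile> D \<Colon> Univ d" for D d
    using wf_Cons[OF wf that] by (intro typing_var) auto
  have "A # \<Gamma> \<turnstile> InL (Var 0) \<Colon> wk 1 (Sm A B)"
    unfolding wk_Sm using typing_wk[OF A A] typing_wk[OF B A] var[OF A] by (auto intro: ty_InL)
  then obtain f where f: "\<Gamma> \<turnstile> f \<Colon> Prd A (App (wk 1 ?C) (InL (Var 0)))"
    using branch[OF A _ sum_branch_typing(1)[OF C] assms(1)] by blast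
  have "B # \<Gamma> \<turnstile> InR (Var 0) \<Colon> wk 1 (Sm A B)"
    unfolding wk_Sm using typing_wk[OF A B] typing_wk[OF B B] var[OF B] by (auto intro: ty_InR)
  then obtain g where g: "\<Gamma> \<turnstile> g \<Colon> Prd B (App (wk 1 ?C) (InR (Var 0)))"
    using branch[OF B _ sum_branch_typing(2)[OF C] assms(2)] by blast
  have "wk 1 (Prd D (App (wk 1 C) (InL (Var 0)))) = Prd (wk 1 D) (App (wk 1 (wk 1 C)) (InL (Var 0)))"
    "wk 1 (Prd D (App (wk 1 C) (InR (Var 0)))) = Prd (wk 1 D) (App (wk 1 (wk 1 C)) (InR (Var 0)))" for C D
    by (simp_all add: wk_def ren_ren)
  with typing_wk[OF C S] typing_wk[OF f S] typing_wk[OF g S] var[OF S]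
  have "Sm A B # \<Gamma> \<turnstile> SumInd (wk 1 ?C) (wk 1 f) (wk 1 g) (Var 0) \<Colon> App (wk 1 ?C) (Var 0)"
    by (intro ty_SumInd) (simp_all only: wk_Sm, simp_all add: wk_def)
  then show "\<exists>t. Sm A B # \<Gamma> \<turnstile> t \<Colon> T"
    using T wk_Lam_Var_conv ty_conv by blast
qed

text \<open>One hypothesis is replaced by two, so every other index in the goal grows by
  one.\<close>

lemma provable_Sg_left:
  assumes "B # A # \<Gamma> \<tturnstile> sub (case_nat (Pr (Var 1) (Var 0)) (\<lambda>i. Var (i + 2))) T"
  shows "Sg A B # \<Gamma> \<tturnstile> T"
  unfolding provable_def
proof (intro impI, elim exE)
  fix k assume wf': "wf_ctx (Sg A B # \<Gamma>)" and T: "Sg A B # \<Gamma> \<turnstile> T \<Colon> Univ k"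
  then obtain l where wf: "wf_ctx \<Gamma>" and S: "\<Gamma> \<turnstile> Sg A B \<Colon> Univ l"
    by (auto elim: wf_ctx.cases)
  then obtain i j where A: "\<Gamma> \<turnstile> A \<Colon> Univ i" and B: "A # \<Gamma> \<turnstile> B \<Colon> Univ j"
    using Sg_inversion by blast
  have wfAB: "wf_ctx ([B, A] @ \<Gamma>)" using wf A B by (auto intro: wf_Cons)
  let ?C = "Lam (Sg A B) T" and ?p = "Pr (Var 1) (Var 0)"
  let ?B = "ren (up_ren (\<lambda>i. i + 2)) B"
  have C: "\<Gamma> \<turnstile> ?C \<Colon> Prd (Sg A B) (Univ k)" using T by (rule typing_family)
  have wk_Sg: "wk 2 (Sg A B) = Sg (wk 2 A) ?B" by (simp add: wk_def)
  have "[B, A] @ \<Gamma> \<turnstile> Sg (wk 2 A) ?B \<Colon> Univ l"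
    using typing_wk_append[OF S wfAB, of 2] by (simp add: wk_Sg)
  then obtain i' j' where A': "[B, A] @ \<Gamma> \<turnstile> wk 2 A \<Colon> Univ i'" and B': "wk 2 A # [B, A] @ \<Gamma> \<turnstile> ?B \<Colon> Univ j'"
    using Sg_inversion by blast
  \<comment> \<open>The second component must have type \<open>B\<close> instantiated at the first;
    after two weakenings this is \<open>wk 1 B\<close>, the type of \<open>Var 0\<close>.\<close>
  have "case_nat (Var 1) (\<lambda>i. Var (i + 2)) = (\<lambda>i. Var (i + 1))"
    by (rule ext) (simp split: nat.split)
  then have "inst ?B (Var 1) = wk 1 B"
    by (simp add: inst_ren_up) (simp add: wk_def ren_eq_sub)
  then have p: "[B, A] @ \<Gamma> \<turnstile> ?p \<Colon> wk 2 (Sg A B)"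
    unfolding wk_Sg using wfAB by (intro ty_Pr[OF A' B'] typing_var) (simp_all add: numeral_2_eq_2)
  have "[B, A] @ \<Gamma> \<turnstile> sub (case_nat ?p (\<lambda>i. Var (i + 2))) T \<Colon> Univ k"
    using typing_sub_append[OF T p] by simp
  then obtain t where "[B, A] @ \<Gamma> \<turnstile> t \<Colon> sub (case_nat ?p (\<lambda>i. Var (i + 2))) T"
    using assms wfAB unfolding provable_def by auto
  moreover have "[B, A] @ \<Gamma> \<turnstile> wk 2 ?C \<Colon> Prd (wk 2 (Sg A B)) (Univ k)"
    using typing_wk_append[OF C wfAB, of 2] by (simp add: wk_def)
  then have Cp: "[B, A] @ \<Gamma> \<turnstile> App (wk 2 ?C) ?p \<Colon> Univ k"
    using ty_App[OF _ p] by (fastforce simp: inst_def)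
  ultimately have "[B, A] @ \<Gamma> \<turnstile> t \<Colon> App (wk 2 ?C) ?p"
    using wk_Lam_conv conv_sym ty_conv by blast
  then have t: "B # A # \<Gamma> \<turnstile> t \<Colon> App (wk 2 ?C) ?p" by simp
  have Cp': "A # \<Gamma> \<turnstile> Prd B (App (wk 2 ?C) ?p) \<Colon> Univ (max j k)"
    using ty_Prd[OF B] Cp by simp
  have g: "\<Gamma> \<turnstile> Lam A (Lam B t) \<Colon> Prd A (Prd B (App (wk 2 ?C) ?p))"
    using ty_Lam[OF A Cp' ty_Lam[OF B _ t]] Cp by simp
  have wk_g: "wk 1 (Prd A (Prd B (App (wk 2 C) ?p))) =
      Prd (wk 1 A) (Prd (ren (up_ren (\<lambda>i. i + 1)) B) (App (wk 2 (wk 1 C)) ?p))" for C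
    by (simp add: wk_def ren_ren numeral_2_eq_2)
  have wk_Sg1: "wk 1 (Sg A B) = Sg (wk 1 A) (ren (up_ren (\<lambda>i. i + 1)) B)"
    by (simp add: wk_def)
  have "Sg A B # \<Gamma> \<turnstile> wk 1 ?C \<Colon> Prd (Sg (wk 1 A) (ren (up_ren (\<lambda>i. i + 1)) B)) (Univ k)"
    using typing_wk[OF C S] by (simp add: wk_def)
  moreover have "Sg A B # \<Gamma> \<turnstile> Var 0 \<Colon> Sg (wk 1 A) (ren (up_ren (\<lambda>i. i + 1)) B)"
    using wf' by (intro typing_var) (simp_all add: wk_Sg1[simplified])
  ultimately have "Sg A B # \<Gamma> \<turnstile> Split (wk 1 ?C) (wk 1 (Lam A (Lam B t))) (Var 0) \<Colon> App (wk 1 ?C) (Var 0)"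
    using typing_wk[OF g S] unfolding wk_g by (intro ty_Split)
  then show "\<exists>t. Sg A B # \<Gamma> \<turnstile> t \<Colon> T"
    using T wk_Lam_Var_conv ty_conv by blast
qed

lemma wf_ctx_is_type: "wf_ctx \<Gamma> \<Longrightarrow> is_type \<Gamma> A \<Longrightarrow> wf_ctx (A # \<Gamma>)"
  using is_type_sound wf_Cons by blast

section \<open>Evaluation of the checker by rewriting\<close>

lemma expect_simps:
  "expect None S = Some S"
  "expect (Some T) S = (if convertible 5 S T then Some T else None)"
  by (simp_all add: expect_def)

lemma app_simps:
  "app (Lam A t) a = inst t a"
  "app (Var i) a = App (Var i) a"
  "app (App f b) a = App (App f b) a"
  "app (SumInd C f g s) a = App (SumInd C f g s) a"
  by (simp_all add: app_def)

lemma sum_case_simps: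
  "sum_case C f g (InL a) = app f a"
  "sum_case C f g (InR b) = app g b"
  "sum_case C f g (Var i) = SumInd C f g (Var i)"
  "sum_case C f g (App t a) = SumInd C f g (App t a)"
  by (simp_all add: sum_case_def)

lemma as_simps:
  "as_Univ (Some (Univ i)) = Some i"
  "as_Prd (Some (Prd A B)) = Some (A, B)"
  "as_Sm (Some (Sm A B)) = Some (A, B)"
  by (simp_all add: as_Univ_def as_Prd_def as_Sm_def)

lemmas compute = numeral_eq_Suc inst_def wk_def Arr_def Prod_def IsProp_def Neg_def
  app_simps sum_case_simps expect_simps as_simps

text \<open>Here the family \<open>Var 3\<close> is transported along the path \<open>Var 0\<close> from \<open>Var 2\<close> to \<open>Var 1\<close>.\<close>

lemma typing_transport:
  fixes i k :: nat
  defines "\<Gamma> \<equiv> [Eq (Var 3) (Var 1) (Var 0), Var 2, Var 1, Arr (Var 0) (Univ k), Univ i]"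
  shows "\<exists>t. \<Gamma> \<turnstile> t \<Colon> Prd (App (Var 3) (Var 2)) (App (Var 4) (Var 2))"
proof -
  let ?C = "Lam (Var 4) (Lam (Var 5) (Lam (Eq (Var 6) (Var 1) (Var 0))
    (Prd (App (Var 6) (Var 2)) (App (Var 7) (Var 2)))))"
  let ?D = "Prd (Var 4) (App (App2 (wk 1 ?C) (Var 0) (Var 0)) (Refl (Var 0)))"
  have wf: "wf_ctx \<Gamma>"
    unfolding \<Gamma>_def by (intro wf_ctx_is_type wf_Nil) (simp_all add: compute)
  have "infer ?C \<Gamma> None = Some (Prd (Var 4) (Prd (wk 1 (Var 4)) (Prd (Eq (wk 2 (Var 4)) (Var 1) (Var 0)) (Univ k))))"
    by (simp add: \<Gamma>_def compute)
  then have C: "\<Gamma> \<turnstile> ?C \<Colon> Prd (Var 4) (Prd (wk 1 (Var 4)) (Prd (Eq (wk 2 (Var 4)) (Var 1) (Var 0)) (Univ k)))"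
    using wf by (rule infer_None_sound)
  have "infer (Lam (Var 4) (Lam (App (Var 4) (Var 0)) (Var 0))) \<Gamma> (Some ?D) \<noteq> None" "is_type \<Gamma> ?D"
    by (simp_all add: \<Gamma>_def compute)
  then have d: "\<Gamma> \<turnstile> Lam (Var 4) (Lam (App (Var 4) (Var 0)) (Var 0)) \<Colon> ?D"
    using is_type_sound infer_Some_sound wf by blast
  have p: "\<Gamma> \<turnstile> Var 0 \<Colon> Eq (Var 4) (Var 2) (Var 1)"
    using wf by (intro typing_var) (simp_all add: \<Gamma>_def wk_def)
  have "convertible 5 (App (App2 ?C (Var 2) (Var 1)) (Var 0)) (Prd (App (Var 3) (Var 2)) (App (Var 4) (Var 2)))"
    "is_type \<Gamma> (Prd (App (Var 3) (Var 2)) (App (Var 4) (Var 2)))"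
    by (simp_all add: \<Gamma>_def compute)
  then show ?thesis
    using ty_J[OF C d p] convertible_conv is_type_sound[OF _ wf] ty_conv by blast
qed

text \<open>Transport is derived once over a context of variables, where the checker can verify
  motive and diagonal case by evaluation, and is specialized here by substitution. Read backwards,
  the goal at \<open>b\<close> is reduced to the one at \<open>a\<close>.\<close>

lemma provable_transport:
  assumes "infer p \<Gamma> None = Some (Eq A a b)" "is_type (A # \<Gamma>) C" "inst C b = T" "\<Gamma> \<tturnstile> inst C a"
  shows "\<Gamma> \<tturnstile> T"
  unfolding provable_def
proof (intro impI)
  assume wf: "wf_ctx \<Gamma>" and T: "\<exists>i. \<Gamma> \<turnstile> T \<Colon> Univ i"
  have p: "\<Gamma> \<turnstile> p \<Colon> Eq A a b" using assms(1) wf by (rule infer_None_sound)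
  then obtain i where A: "\<Gamma> \<turnstile> A \<Colon> Univ i" and a: "\<Gamma> \<turnstile> a \<Colon> A" and b: "\<Gamma> \<turnstile> b \<Colon> A"
    by (meson Eq_inversion typing_regular)
  obtain k where C: "A # \<Gamma> \<turnstile> C \<Colon> Univ k"
    using is_type_sound[OF assms(2)] wf_Cons[OF wf A] by blast
  have F: "\<Gamma> \<turnstile> Lam A C \<Colon> Prd A (Univ k)" using C by (rule typing_family)
  obtain t where t: "[Eq (Var 3) (Var 1) (Var 0), Var 2, Var 1, Arr (Var 0) (Univ k), Univ i] \<turnstile> t
      \<Colon> Prd (App (Var 3) (Var 2)) (App (Var 4) (Var 2))"
    using typing_transport by blast
  \<comment> \<open>The values for \<open>Var 0\<close> to \<open>Var 4\<close>, so the innermost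
    entry comes first.\<close>
  define s where "s i = [p, b, a, Lam A C, A] ! i" for i
  have "\<Gamma> \<turnstile> sub s t \<Colon> sub s (Prd (App (Var 3) (Var 2)) (App (Var 4) (Var 2)))"
    using t wf
  proof (rule typing_sub)
    fix j assume "j < length [Eq (Var 3) (Var 1) (Var 0), Var 2, Var 1, Arr (Var 0) (Univ k), Univ i]"
    then consider "j = 0" | "j = 1" | "j = 2" | "j = 3" | "j = 4" by fastforce
    then show "\<Gamma> \<turnstile> s j \<Colon> sub s (wk (Suc j) ([Eq (Var 3) (Var 1) (Var 0), Var 2, Var 1,
        Arr (Var 0) (Univ k), Univ i] ! j))"
      by cases (simp_all add: s_def numeral_eq_Suc Arr_def wk_def p a b A F)
  qed
  then have t: "\<Gamma> \<turnstile> sub s t \<Colon> Prd (App (Lam A C) a) (App (wk 1 (Lam A C)) (wk 1 b))"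
    by (simp add: s_def numeral_eq_Suc)
  have "\<Gamma> \<turnstile> inst C a \<Colon> Univ k" using typing_inst[OF C a] by (simp add: inst_def)
  then obtain u where "\<Gamma> \<turnstile> u \<Colon> inst C a"
    using assms(4) wf unfolding provable_def by blast
  moreover have "\<Gamma> \<turnstile> App (Lam A C) a \<Colon> Univ k" using ty_App[OF F a] by (simp add: inst_def)
  ultimately have "\<Gamma> \<turnstile> u \<Colon> App (Lam A C) a"
    using beta conv_sym ty_conv by blast
  moreover have "inst (App (wk 1 f) (wk 1 b)) u = App f b" for f
    by (simp add: inst_def sub_wk)
  ultimately have "\<Gamma> \<turnstile> App (sub s t) u \<Colon> App (Lam A C) b"
    using ty_App[OF t] by metis
  moreover have "App (Lam A C) b \<approx> T" using beta assms(3) by blast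
  ultimately show "\<exists>t. \<Gamma> \<turnstile> t \<Colon> T"
    using T ty_conv by blast
qed

lemma provable_InL: "\<Gamma> \<tturnstile> A \<Longrightarrow> \<Gamma> \<tturnstile> Sm A B"
  unfolding provable_def by (meson Sm_inversion ty_InL)

lemma provable_InR: "\<Gamma> \<tturnstile> B \<Longrightarrow> \<Gamma> \<tturnstile> Sm A B"
  unfolding provable_def by (meson Sm_inversion ty_InR)

text \<open>Weakening and reordering of hypotheses in one step. A term over \<open>\<Gamma>\<close>
  is extracted before it is renamed, so the source sequent must be well formed.\<close>

lemma provable_ren:
  assumes "\<Gamma> \<tturnstile> T" "wf_ctx \<Gamma>" "is_type \<Gamma> T" "ren r T = T'"
    and "\<And>i. i < length \<Gamma> \<Longrightarrow> r i < length \<Delta> \<and> ren r (wk (Suc i) (\<Gamma> ! i)) = wk (Suc (r i)) (\<Delta> ! r i)"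
  shows "\<Delta> \<tturnstile> T'"
proof -
  obtain t where "\<Gamma> \<turnstile> t \<Colon> T"
    using assms(1-3) is_type_sound unfolding provable_def by blast
  then have "\<Delta> \<turnstile> ren r t \<Colon> T'" if "wf_ctx \<Delta>"
    using typing_ren[OF _ that assms(5)] assms(4) by blast
  then show ?thesis unfolding provable_def by blast
qed

text \<open>With the universe left unspecified, a large type can be checked component by
  component.\<close>

definition wf_type :: "tm list \<Rightarrow> tm \<Rightarrow> bool" where
  "wf_type \<Gamma> A \<longleftrightarrow> (wf_ctx \<Gamma> \<longrightarrow> (\<exists>i. \<Gamma> \<turnstile> A \<Colon> Univ i))"

lemma wf_type_is_type: "is_type \<Gamma> A \<Longrightarrow> wf_type \<Gamma> A"
  using is_type_sound unfolding wf_type_def by blast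

lemma wf_type_Sg: "wf_type \<Gamma> A \<Longrightarrow> wf_type (A # \<Gamma>) B \<Longrightarrow> wf_type \<Gamma> (Sg A B)"
  unfolding wf_type_def by (meson ty_Sg wf_Cons)

lemma wf_type_wk: "wf_ctx \<Gamma> \<Longrightarrow> wf_type \<Gamma> A \<Longrightarrow> wf_type \<Gamma> B \<Longrightarrow> \<exists>j. A # \<Gamma> \<turnstile> wk 1 B \<Colon> Univ j"
  unfolding wf_type_def using typing_wk wk_Univ by metis

lemma wf_type_Prod: "wf_type \<Gamma> A \<Longrightarrow> wf_type \<Gamma> B \<Longrightarrow> wf_type \<Gamma> (Prod A B)"
  using wf_type_wk unfolding wf_type_def Prod_def by (meson ty_Sg)

lemma wf_type_Arr: "wf_type \<Gamma> A \<Longrightarrow> wf_type \<Gamma> B \<Longrightarrow> wf_type \<Gamma> (Arr A B)"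
  using wf_type_wk unfolding wf_type_def Arr_def by (meson ty_Prd)

lemma inhabited_provable: "wf_type [] A \<Longrightarrow> [] \<tturnstile> A \<Longrightarrow> inhabited A"
  using wf_Nil unfolding wf_type_def provable_def inhabited_def by blast

lemma provable_convertible:
  "convertible 5 T T' \<Longrightarrow> is_type \<Gamma> T' \<Longrightarrow> \<Gamma> \<tturnstile> T' \<Longrightarrow> \<Gamma> \<tturnstile> T"
  using provable_conv convertible_conv by blast

lemma provable_ProdI: "\<Gamma> \<tturnstile> A \<Longrightarrow> \<Gamma> \<tturnstile> B \<Longrightarrow> \<Gamma> \<tturnstile> Prod A B"
  unfolding Prod_def by (rule provable_Prod) simp_all

declare compute [simp]

lemmas poset_defs [simp] = Disj_def DecEq_def WEM_def PropValued_def Reflexive_def Transitive_def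
  Antisymmetric_def IsPoset_def Nontrivial_def LocallySmall_def Equiv_def IsUB_def IsSup_def HasSup_def
  Delta_def DeltaComplete_def NontrivialDecidablePosets_def

section \<open>From a poset to weak excluded middle\<close>

lemma wf_type_posets: "wf_type [] (NontrivialDecidablePosets u t v)"
  unfolding NontrivialDecidablePosets_def
  apply (intro wf_type_Sg wf_type_Prod wf_type_is_type, simp_all)
  done

text \<open>
  The part of the structure that is used. The innermost entries say \<open>x \<noteq> y\<close> and \<open>x \<sqsubseteq> y\<close>, and are
  followed by \<open>y\<close> and \<open>x\<close>.
\<close>

definition poset_ctx :: "nat \<Rightarrow> nat \<Rightarrow> nat \<Rightarrow> tm list" where
  "poset_ctx u t v =
    [Neg (Eq (Var 8) (Var 2) (Var 1)), App2 (Var 6) (Var 1) (Var 0), Var 6, Var 5, DecEq (Var 4),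
     DeltaComplete v (Var 3) (Var 2), Antisymmetric (Var 2) (Var 1), Reflexive (Var 1) (Var 0),
     Arr (Var 0) (Arr (Var 0) (Univ t)), Univ u]"

lemma poset_ctx_WEM: "poset_ctx u t v \<tturnstile> WEM v"
  unfolding poset_ctx_def
  apply simp
  apply (rule provable_Prd)+
  \<comment> \<open>the supremum \<open>s\<close>\<close>
  apply (rule provable_cut_term[of "App (App2 (App2 (Var 7) (Var 5) (Var 4)) (Var 3) (Var 1)) (Var 0)"],
      simp, simp)
  apply (rule provable_Sg_left, simp)+
  \<comment> \<open>decide \<open>s = x\<close>\<close>
  apply (rule provable_cut_term[of "App2 (Var 9) (Var 2) (Var 8)"], simp, simp)
  apply (rule provable_Sm_left, simp_all)
  apply (rule provable_Trunc)
  apply (rule provable_InL)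
  apply (rule provable_Prd)
  \<comment> \<open>from \<open>P\<close> we get \<open>y \<sqsubseteq> s\<close>, hence \<open>y \<sqsubseteq> x\<close>\<close>
  apply (rule provable_cut[where A = "App2 (Var 15) (Var 9) (Var 4)"], simp)
  apply (rule provable_infer[of "App (Var 3) (InR (Var 0))"], simp, simp)
  apply (rule provable_cut[where A = "App2 (Var 16) (Var 10) (Var 11)"], simp)
  apply (rule provable_transport[of "Var 2" _ _ _ _ "App2 (Var 17) (Var 11) (Var 0)"], simp, simp, simp)
  apply (rule provable_infer[of "Var 0"], simp, simp)
  \<comment> \<open>Together with \<open>x \<sqsubseteq> y\<close>, antisymmetry contradicts the
    choice of distinct elements.\<close>
  apply (rule provable_infer[of "App (Var 9) (App2 (App2 (Var 15) (Var 12) (Var 11)) (Var 10) (Var 0))"], simp)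
  apply (rule provable_Trunc)
  apply (rule provable_InR)
  apply (rule provable_Prd)
  \<comment> \<open>from the negation of \<open>P\<close> we get that \<open>x\<close> is an upper bound\<close>
  apply (rule provable_cut[where A = "IsUB (Var 15) (Sm (One 0) (Var 6))
    (Delta (Var 16) (Var 10) (Var 9) (Var 6)) (Var 10)"])
  apply (simp, simp)
  apply (rule provable_Prd)
  apply (rule provable_Sm_left, simp_all)
  apply (rule provable_infer[of "App (Var 15) (Var 11)"], simp)
  apply (rule provable_Emp_elim[of "App (Var 1) (Var 0)" _ 0], simp)
  \<comment> \<open>Leastness puts \<open>s\<close> below \<open>x\<close>, and the value at
    \<open>InL\<close> puts \<open>x\<close> below \<open>s\<close>, so antisymmetry gives the
    excluded equation \<open>s = x\<close>.\<close>
  apply (rule provable_infer[of "App (Var 2) (App2 (App2 (Var 14) (Var 5) (Var 11))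
    (App2 (Var 3) (Var 11) (Var 0)) (App (Var 4) (InL (Star 0))))"], simp)
  done

lemma wf_poset_ctx: "wf_ctx (poset_ctx u t v)"
  unfolding poset_ctx_def
  apply (intro wf_ctx_is_type wf_Nil, simp_all)
  done

lemma WEM_of_posets: "[] \<tturnstile> Arr (NontrivialDecidablePosets u t v) (WEM v)"
  unfolding Arr_def
  apply (rule provable_Prd, simp)
  apply (rule provable_Sg_left, simp)+
  \<comment> \<open>Left rules act on the innermost hypothesis only, so a copy of the poset axioms
    is moved there; the same is done below for nontriviality.\<close>
  apply (rule provable_cut_term[of "Var 4"], simp, simp)
  apply (rule provable_Sg_left, simp)+
  apply (rule provable_cut_term[of "Var 7"], simp, simp)
  apply (rule provable_Sg_left, simp)+
  \<comment> \<open>Entry \<open>i\<close> of the list is the place, in the unpacked structure, of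
    hypothesis \<open>i\<close> of \<open>poset_ctx\<close>.\<close>
  apply (rule provable_ren[OF poset_ctx_WEM wf_poset_ctx, 
    where r = "\<lambda>i. [0, 1, 2, 3, 8, 9, 4, 6, 13, 14] ! i"])
  apply (simp add: poset_ctx_def)
  apply (simp add: poset_ctx_def)
  apply (simp only: poset_ctx_def list.size add_0_right add_Suc_right less_Suc_eq)
  apply (elim disjE)
  apply (simp_all add: poset_ctx_def)
  done

section \<open>From weak excluded middle to a poset\<close>

definition two :: "nat \<Rightarrow> tm" where
  "two u = Sm (One u) (One u)"

text \<open>
  The order of the two-element chain with bottom \<open>InL\<close>. Taking \<open>l\<close> to be the universe of the order,
  the universe of local smallness and \<open>0\<close> gives the order itself, its small copy, and a family
  that distinguishes the two elements.
\<close>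

definition two_le :: "nat \<Rightarrow> nat \<Rightarrow> tm" where
  "two_le u l = Lam (two u) (Lam (two u)
    (SumInd (Lam (two u) (Univ l))
      (Lam (One u) (One l))
      (Lam (One u) (SumInd (Lam (two u) (Univ l)) (Lam (One u) (Emp l)) (Lam (One u) (One l)) (Var 1)))
      (Var 1)))"

declare two_def [simp] two_le_def [simp]

section \<open>Order, nontriviality, smallness and decidability for the two-element chain\<close>

lemma IsProp_One: "\<Gamma> \<tturnstile> IsProp (One l)"
  unfolding IsProp_def
  apply (rule provable_Prd)
  apply (rule provable_One_left, simp)
  apply (rule provable_Prd)
  apply (rule provable_One_left, simp)
  apply (rule provable_Refl)
  done

lemma IsProp_Emp: "\<Gamma> \<tturnstile> IsProp (Emp l)"
  unfolding IsProp_def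
  apply (rule provable_Prd)
  apply (rule provable_Emp_elim[of "Var 0" _ l], simp)
  done

text \<open>By cases the order computes to \<open>One t\<close> or \<open>Emp t\<close>. If the
  first argument is the bottom, the value is \<open>One t\<close> whatever the second; only the top
  requires a further case distinction. The order axioms below follow the same pattern.\<close>

lemma PropValued_two: "\<Gamma> \<tturnstile> PropValued (two u) (two_le u t)"
  apply simp
  apply (rule provable_Prd)
  apply (rule provable_Sm_left, simp_all)
  apply (rule provable_Prd)
  apply (rule provable_convertible[where T' = "IsProp (One t)"], simp, simp)
  apply (rule IsProp_One)
  apply (rule provable_Prd)
  apply (rule provable_Sm_left, simp_all)
  apply (rule provable_convertible[where T' = "IsProp (Emp t)"], simp, simp)
  apply (rule IsProp_Emp)
  apply (rule provable_convertible[where T' = "IsProp (One t)"], simp, simp)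
  apply (rule IsProp_One)
  done

lemma Reflexive_two: "\<Gamma> \<tturnstile> Reflexive (two u) (two_le u t)"
  apply simp
  apply (rule provable_Prd)
  apply (rule provable_Sm_left)
  apply (rule provable_infer[of "Star t"], simp)
  apply (rule provable_infer[of "Star t"], simp)
  done

lemma Transitive_two: "\<Gamma> \<tturnstile> Transitive (two u) (two_le u t)"
  apply simp
  apply (rule provable_Prd)
  apply (rule provable_Sm_left, simp_all)
  apply (rule provable_Prd)+
  apply (rule provable_infer[of "Star t"], simp)
  apply (rule provable_Prd)
  apply (rule provable_Sm_left, simp_all)
  apply (rule provable_Prd)
  apply (rule provable_Prd)
  apply (rule provable_Emp_elim[of "Var 0" _ t], simp)
  apply (rule provable_Prd)+
  \<comment> \<open>When the first two elements are both the top, the goal coincides with the second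
    hypothesis.\<close>
  apply (rule provable_infer[of "Var 0"], simp)
  done

lemma Antisymmetric_two: "\<Gamma> \<tturnstile> Antisymmetric (two u) (two_le u t)"
  apply simp
  apply (rule provable_Prd)
  apply (rule provable_Sm_left, simp_all)
  apply (rule provable_Prd)
  apply (rule provable_Sm_left, simp_all)
  apply (rule provable_One_left, simp)
  apply (rule provable_One_left, simp)
  apply (rule provable_Prd)+
  apply (rule provable_Refl)
  apply (rule provable_Prd)+
  apply (rule provable_Emp_elim[of "Var 0" _ t], simp)
  apply (rule provable_Prd)
  apply (rule provable_Sm_left, simp_all)
  apply (rule provable_Prd)
  apply (rule provable_Emp_elim[of "Var 0" _ t], simp)
  apply (rule provable_One_left, simp)
  apply (rule provable_One_left, simp)
  apply (rule provable_Prd)+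
  apply (rule provable_Refl)
  done

lemma IsPoset_two: "\<Gamma> \<tturnstile> IsPoset (two u) (two_le u t)"
  unfolding IsPoset_def
  by (intro provable_ProdI PropValued_two Reflexive_two Transitive_two Antisymmetric_two)

text \<open>A path from bottom to top would carry bottom \<le> bottom, which is
  \<open>One 0\<close>, to top \<le> bottom, which is \<open>Emp 0\<close>. The order at level 0 is
  used because negation ends in \<open>Emp 0\<close>.\<close>

lemma InL_neq_InR: "\<Gamma> \<tturnstile> Neg (Eq (two u) (InL (Star u)) (InR (Star u)))"
  apply simp
  apply (rule provable_Prd)
  apply (rule provable_convertible[where T' = "App2 (two_le u 0) (InR (Star u)) (InL (Star u))"])
  apply (simp, simp)
  apply (rule provable_transport[of "Var 0" _ _ _ _ "App2 (two_le u 0) (Var 0) (InL (Star u))"])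
  apply (simp, simp, simp)
  apply (rule provable_infer[of "Star 0"], simp)
  done

lemma InR_neq_InL: "\<Gamma> \<tturnstile> Neg (Eq (two u) (InR (Star u)) (InL (Star u)))"
  apply simp
  apply (rule provable_Prd)
  apply (rule provable_convertible[where T' = "App2 (two_le u 0) (InR (Star u)) (InL (Star u))"])
  apply (simp, simp)
  \<comment> \<open>For the reversed path the second argument varies: top \<le> top is carried to
    top \<le> bottom.\<close>
  apply (rule provable_transport[of "Var 0" _ _ _ _ "App2 (two_le u 0) (InR (Star u)) (Var 0)"])
  apply (simp, simp, simp)
  apply (rule provable_infer[of "Star 0"], simp)
  done

lemma Nontrivial_two: "\<Gamma> \<tturnstile> Nontrivial (two u) (two_le u t)"
  apply simp
  apply (rule provable_Sg[of "InL (Star u)"], simp, simp)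
  apply (rule provable_Sg[of "InR (Star u)"], simp, simp)
  apply (rule provable_Prod, simp)
  apply (rule provable_infer[of "Star t"], simp)
  using InL_neq_InR[of \<Gamma> u]
  apply simp
  done

lemma Equiv_One: "\<Gamma> \<tturnstile> Equiv (One s) (One t)"
  apply simp
  apply (rule provable_Sg[of "Lam (One s) (Star t)"], simp, simp)
  apply (rule provable_Prod, simp, simp_all)
  apply (rule provable_Sg[of "Lam (One t) (Star s)"], simp, simp)
  apply (rule provable_Prd)
  apply (rule provable_One_left)
  apply (rule provable_convertible[where T' = "Eq (One s) (Star s) (Star s)"], simp, simp)
  apply (rule provable_Refl)
  apply (rule provable_Sg[of "Lam (One t) (Star s)"], simp, simp)
  apply (rule provable_Prd)
  apply (rule provable_One_left)
  apply (rule provable_convertible[where T' = "Eq (One t) (Star t) (Star t)"], simp, simp)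
  apply (rule provable_Refl)
  done

text \<open>The checker does not treat \<open>EmpInd\<close>. Maps between copies of the empty type
  are therefore brought in by cut, as variables that can occur in witnesses.\<close>

lemma Emp_Emp: "\<Gamma> \<tturnstile> Arr (Emp s) (Emp t)"
  unfolding Arr_def
  apply (rule provable_Prd)
  apply (rule provable_Emp_elim[of "Var 0" _ s], simp)
  done

lemma Equiv_Emp: "\<Gamma> \<tturnstile> Equiv (Emp s) (Emp t)"
  apply (rule provable_cut[OF _ Emp_Emp[of _ s t]], simp)
  apply (rule provable_cut[OF _ Emp_Emp[of _ t s]], simp, simp)
  apply (rule provable_Sg[of "Var 1"], simp, simp)
  apply (rule provable_Prod, simp, simp_all)
  apply (rule provable_Sg[of "Var 0"], simp, simp)
  apply (rule provable_Prd)
  apply (rule provable_Emp_elim[of "Var 0" _ s], simp)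
  apply (rule provable_Sg[of "Var 0"], simp, simp)
  apply (rule provable_Prd)
  apply (rule provable_Emp_elim[of "Var 0" _ t], simp)
  done

lemma LocallySmall_two: "\<Gamma> \<tturnstile> LocallySmall v (two u) (two_le u t)"
  apply simp
  apply (rule provable_Sg[of "two_le u v"], simp, simp)
  apply (rule provable_Prd)
  apply (rule provable_Sm_left, simp_all)
  apply (rule provable_Prd)
  apply (rule provable_convertible[where T' = "Equiv (One t) (One v)"], simp, simp)
  apply (rule Equiv_One)
  apply (rule provable_Prd)
  apply (rule provable_Sm_left, simp_all)
  apply (rule provable_convertible[where T' = "Equiv (Emp t) (Emp v)"], simp, simp)
  apply (rule Equiv_Emp)
  apply (rule provable_convertible[where T' = "Equiv (One t) (One v)"], simp, simp)
  apply (rule Equiv_One)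
  done

lemma DecEq_two: "\<Gamma> \<tturnstile> DecEq (two u)"
  apply simp
  apply (rule provable_Prd)
  apply (rule provable_Sm_left, simp_all)
  apply (rule provable_One_left, simp)
  apply (rule provable_Prd)
  apply (rule provable_Sm_left, simp_all)
  apply (rule provable_One_left, simp)
  apply (rule provable_InL)
  apply (rule provable_Refl)
  apply (rule provable_One_left, simp)
  apply (rule provable_InR)
  using InL_neq_InR[of \<Gamma> u] apply simp
  apply (rule provable_One_left, simp)
  apply (rule provable_Prd)
  apply (rule provable_Sm_left, simp_all)
  apply (rule provable_One_left, simp)
  apply (rule provable_InR)
  using InR_neq_InL[of \<Gamma> u] apply simp
  apply (rule provable_One_left, simp)
  apply (rule provable_InL)
  apply (rule provable_Refl)
  done

section \<open>Removing the truncation, and delta-completeness of the chain\<close>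

definition decide_Neg :: "nat \<Rightarrow> tm" where
  "decide_Neg v = Prd (Univ v) (Arr (IsProp (Var 0)) (Sm (Neg (Var 0)) (Neg (Neg (Var 0)))))"

definition Stable :: "tm \<Rightarrow> tm \<Rightarrow> tm" where
  "Stable X R = Prd X (Prd (wk 1 X)
    (Arr (Neg (Neg (App2 (wk 2 R) (Var 1) (Var 0)))) (App2 (wk 2 R) (Var 1) (Var 0))))"

declare decide_Neg_def [simp] Stable_def [simp]

text \<open>To eliminate the truncation, the plain sum must be a proposition. Two elements on
  different sides contradict each other; on the same side they are maps into the empty type, which
  agree by function extensionality.\<close>

lemma decide_Neg: "[WEM v] \<tturnstile> decide_Neg v"
  unfolding decide_Neg_def
  apply simp
  apply (rule provable_Prd)+
  apply (rule provable_Trunc_elim[of "App2 (Var 2) (Var 1) (Var 0)"], simp)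
  prefer 2 \<comment> \<open>that the untruncated sum is a proposition is shown last\<close>
  apply simp
  apply (rule provable_infer[of "Var 0"], simp, simp)
  apply (rule provable_Prd)
  apply (rule provable_Sm_left, simp_all)
  apply (rule provable_Prd)
  apply (rule provable_Sm_left, simp_all)
  apply (rule provable_cut[where A = "Eq (Neg (Var 3)) (Var 1) (Var 0)"], simp, simp)
  apply (rule provable_FunExt)
  apply (rule provable_Emp_elim[of "App (Var 1) (Var 0)" _ 0], simp, simp)
  \<comment> \<open>Congruence of \<open>InL\<close>: reflexivity is transported in the right
    endpoint. The same is done for \<open>InR\<close> below.\<close>
  apply (rule provable_transport[of "Var 0" _ _ _ _
    "Eq (Sm (Neg (Var 5)) (Neg (Neg (Var 5)))) (InL (Var 3)) (InL (Var 0))"])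
  apply (simp, simp, simp, simp)
  apply (rule provable_Refl)
  apply (rule provable_Emp_elim[of "App (Var 0) (Var 1)" _ 0], simp)
  apply (rule provable_Prd)
  apply (rule provable_Sm_left, simp_all)
  apply (rule provable_Emp_elim[of "App (Var 1) (Var 0)" _ 0], simp)
  apply (rule provable_cut[where A = "Eq (Neg (Neg (Var 3))) (Var 1) (Var 0)"], simp, simp)
  apply (rule provable_FunExt)
  apply (rule provable_Emp_elim[of "App (Var 1) (Var 0)" _ 0], simp, simp)
  apply (rule provable_transport[of "Var 0" _ _ _ _
    "Eq (Sm (Neg (Var 5)) (Neg (Neg (Var 5)))) (InR (Var 3)) (InR (Var 0))"])
  apply (simp, simp, simp, simp)
  apply (rule provable_Refl)
  done

text \<open>The values are copies of \<open>One\<close> and \<open>Emp\<close>, and both are stable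
  under double negation.\<close>

lemma Stable_two: "\<Gamma> \<tturnstile> Stable (two u) (two_le u t)"
  apply simp
  apply (rule provable_Prd)
  apply (rule provable_Sm_left, simp_all)
  apply (rule provable_Prd)+
  apply (rule provable_infer[of "Star t"], simp)
  apply (rule provable_Prd)
  apply (rule provable_Sm_left, simp_all)
  apply (rule provable_Prd)
  \<comment> \<open>The order takes the value \<open>Emp t\<close> whereas negation ends in
    \<open>Emp 0\<close>, so refuting the value needs this map.\<close>
  apply (rule provable_cut[OF _ Emp_Emp[of _ t 0]], simp, simp)
  apply (rule provable_Emp_elim[of "App (Var 1) (Var 0)" _ 0], simp)
  apply (rule provable_Prd)
  apply (rule provable_infer[of "Star t"], simp)
  done

text \<open>Which element is the supremum depends on the alternative that holds, so the case
  distinction is made on the plain sum. Reflexivity and stability enter by cut, which lets explicit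
  proof terms apply them as functions.\<close>

lemma DeltaComplete_two: "[WEM v] \<tturnstile> DeltaComplete v (two u) (two_le u t)"
  apply (rule provable_cut[OF _ decide_Neg], simp)
  apply (rule provable_cut[OF _ Reflexive_two[of _ u t]], simp)
  apply (rule provable_cut[OF _ Stable_two[of _ u t]], simp, simp)
  apply (rule provable_Prd)+
  apply (rule provable_cut_term[of "App2 (Var 7) (Var 1) (Var 0)"], simp, simp)
  apply (rule provable_Sm_left, simp_all)
  \<comment> \<open>if \<open>P\<close> is refuted, the supremum is \<open>x\<close>\<close>
  apply (rule provable_Sg[of "Var 5"], simp, simp)
  apply (rule provable_Prod, simp)
  apply (rule provable_Prd)
  apply (rule provable_Sm_left, simp_all)
  apply (rule provable_infer[of "App (Var 8) (Var 6)"], simp)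
  apply (rule provable_Emp_elim[of "App (Var 1) (Var 0)" _ 0], simp)
  apply (rule provable_Prd)+
  apply (rule provable_infer[of "App (Var 0) (InL (Star 0))"], simp)
  \<comment> \<open>otherwise it is \<open>y\<close>\<close>
  apply (rule provable_Sg[of "Var 4"], simp, simp)
  apply (rule provable_Prod, simp)
  apply (rule provable_Prd)
  apply (rule provable_Sm_left, simp_all)
  \<comment> \<open>That \<open>y\<close> bounds the value \<open>x\<close> is the assumption
    \<open>x \<sqsubseteq> y\<close> on the pair.\<close>
  apply (rule provable_infer[of "Var 4"], simp)
  apply (rule provable_infer[of "App (Var 8) (Var 5)"], simp)
  apply (rule provable_Prd)+
  \<comment> \<open>\<open>y \<sqsubseteq> z\<close> for an upper bound \<open>z\<close>, by stability\<close>
  apply (rule provable_infer[of "App (App2 (Var 8) (Var 6) (Var 1))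
    (Lam (Neg (App2 (two_le u t) (Var 6) (Var 1)))
      (App (Var 3) (Lam (Var 5) (App (Var 1) (App (Var 2) (InR (Var 0)))))))"], simp)
  done

lemma posets_of_WEM: "[] \<tturnstile> Arr (WEM v) (NontrivialDecidablePosets u t v)"
proof -
  let ?P = "\<lambda>X R. Prod (IsPoset X R) (Prod (Nontrivial X R) (Prod (LocallySmall v X R)
    (Prod (DeltaComplete v X R) (DecEq X))))"
  let ?S = "Sg (Arr (two u) (Arr (two u) (Univ t))) (?P (wk 1 (two u)) (Var 0))"
  have "[WEM v] \<tturnstile> ?P (two u) (two_le u t)"
    by (intro provable_ProdI IsPoset_two Nontrivial_two LocallySmall_two DeltaComplete_two DecEq_two)
  \<comment> \<open>The facts about the chain are refolded as instances of the dependent sums, with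
    the order inserted before the carrier.\<close>
  then have "[WEM v] \<tturnstile> inst (?P (wk 1 (two u)) (Var 0)) (two_le u t)"
    by simp
  then have "[WEM v] \<tturnstile> ?S"
    by (rule provable_Sg[rotated]) simp
  then have "[WEM v] \<tturnstile> inst (Sg (Arr (Var 0) (Arr (Var 0) (Univ t))) (?P (Var 1) (Var 0))) (two u)"
    by simp
  then have "[WEM v] \<tturnstile> NontrivialDecidablePosets u t v"
    unfolding NontrivialDecidablePosets_def
    by (rule provable_Sg[rotated]) simp
  \<comment> \<open>The type of posets is closed, so weakening it past the hypothesis
    \<open>WEM v\<close> leaves it unchanged.\<close>
  moreover have "wk 1 (NontrivialDecidablePosets u t v) = NontrivialDecidablePosets u t v"
    by simp
  ultimately show ?thesis
    unfolding Arr_def by (intro provable_Prd) (simp only:)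
qed

theorem theorem4p26:
  fixes u t v :: nat
  shows "inhabited (Iff (NontrivialDecidablePosets u t v) (WEM v))"
proof (rule inhabited_provable)
  have "wf_type [] (WEM v)"
    by (intro wf_type_is_type) simp
  then show "wf_type [] (Iff (NontrivialDecidablePosets u t v) (WEM v))"
    unfolding Iff_def by (intro wf_type_Prod wf_type_Arr wf_type_posets)
  show "[] \<tturnstile> Iff (NontrivialDecidablePosets u t v) (WEM v)"
    unfolding Iff_def by (intro provable_ProdI WEM_of_posets posets_of_WEM)
qed

end
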